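(* Given $m$ strings $s_1,\dots,s_m$ of length $n$ over an alphabet $\Sigma$ and a parameter $\theta\in(0,1)$, there is an algorithm that computes GapMultiAlignDist$(s_1,\dots,s_m,\theta,2-\frac{3\theta}{16})$ in time $\tilde{O}_m(n^{\lfloor m/2\rfloor+2})$.
   Context: $\mathcal{A}(s_1,\dots,s_m)=n-\mathcal{L}(s_1,\dots,s_m)$, where $\mathcal{L}$ is the length of a longest common subsequence. The problem GapMultiAlignDist$(s_1,\dots,s_m,\theta,c)$, for strings of length $n$, $\theta\in(0,1)$ and a constant $c>1$: output $1$ if $\mathcal{A}(s_1,\dots,s_m)\le\theta n$, output $0$ if $\mathcal{A}(s_1,\dots,s_m)>c\theta n$, and output an arbitrary answer otherwise. The notation $\tilde{O}_m(\cdot)$ hides factors of the form $c^m\log^m n$ with $c$ a constant, as well as polylogarithmic factors. *)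

theory Defs
  imports Complex_Main "HOL-Library.Sublist" "HOL-Library.Discrete_Functions"
begin

section \<open>Alignment distance and its gap version\<close>

definition lcs_length :: "'a list list \<Rightarrow> nat" where
  "lcs_length ss = Max {length w |w. \<forall>s \<in> set ss. subseq w s}"

definition align_dist :: "nat \<Rightarrow> 'a list list \<Rightarrow> nat" where
  "align_dist n ss = n - lcs_length ss"

text \<open>The set of admissible outputs of the gap problem; between the two thresholds
  every output is admissible.\<close>

definition GapMultiAlignDist :: "nat \<Rightarrow> 'a list list \<Rightarrow> real \<Rightarrow> real \<Rightarrow> nat set" where
  "GapMultiAlignDist n ss \<theta> c =
     {ans. (real (align_dist n ss) \<le> \<theta> * real n \<longrightarrow> ans = 1) \<and>
           (real (align_dist n ss) > c * \<theta> * real n \<longrightarrow> ans = 0)}"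


section \<open>Random access programs with logarithmic cost\<close>

text \<open>
  Algorithms are programs of a deterministic structured RAM language, working on finitely many
  named, unbounded arrays of natural numbers (cell 0 of an array serves as a scalar variable).
  The cost measure is the logarithmic one: every operation is charged the bit lengths of the
  numbers and addresses it handles, so large numbers give no hidden parallelism.

  The symbols of the input strings need not be numbers; a program can access them only
  through the test \<open>SymEq i p j q\<close>, asking whether the \<open>p\<close>-th symbol of
  the \<open>i\<close>-th string equals the \<open>q\<close>-th symbol of the \<open>j\<close>-th
  string (counting from 0, false if out of range).  Likewise the real parameter \<open>\<theta>\<close>
  is accessible only through comparisons \<open>a \<le> \<theta> * b\<close> with natural numbers
  \<open>a\<close> and \<open>b\<close>.
\<close>

datatype bop = Plus | Minus | Times | Divide | Modulo

datatype aexp =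
    Const nat
  | Arr string aexp
  | Bin bop aexp aexp

datatype bexp =
    Less aexp aexp
  | Equal aexp aexp
  | SymEq aexp aexp aexp aexp
  | LeTheta aexp aexp
  | Neg bexp
  | Conj bexp bexp

datatype com =
    Skip
  | Assign string aexp aexp
  | Seq com com
  | If bexp com com
  | While bexp com

type_synonym state = "string \<Rightarrow> nat \<Rightarrow> nat"

fun bop_val :: "bop \<Rightarrow> nat \<Rightarrow> nat \<Rightarrow> nat" where
  "bop_val Plus x y = x + y"
| "bop_val Minus x y = x - y"
| "bop_val Times x y = x * y"
| "bop_val Divide x y = x div y"
| "bop_val Modulo x y = x mod y"

fun aval :: "aexp \<Rightarrow> state \<Rightarrow> nat" where
  "aval (Const k) \<sigma> = k"
| "aval (Arr x a) \<sigma> = \<sigma> x (aval a \<sigma>)"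
| "aval (Bin f a b) \<sigma> = bop_val f (aval a \<sigma>) (aval b \<sigma>)"

definition sym_eq :: "'a list list \<Rightarrow> nat \<Rightarrow> nat \<Rightarrow> nat \<Rightarrow> nat \<Rightarrow> bool" where
  "sym_eq ss i p j q \<longleftrightarrow>
     i < length ss \<and> p < length (ss ! i) \<and> j < length ss \<and> q < length (ss ! j) \<and>
     ss ! i ! p = ss ! j ! q"

fun bval :: "'a list list \<Rightarrow> real \<Rightarrow> bexp \<Rightarrow> state \<Rightarrow> bool" where
  "bval ss \<theta> (Less a b) \<sigma> \<longleftrightarrow> aval a \<sigma> < aval b \<sigma>"
| "bval ss \<theta> (Equal a b) \<sigma> \<longleftrightarrow> aval a \<sigma> = aval b \<sigma>"
| "bval ss \<theta> (SymEq i p j q) \<sigma> \<longleftrightarrow> sym_eq ss (aval i \<sigma>) (aval p \<sigma>) (aval j \<sigma>) (aval q \<sigma>)"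
| "bval ss \<theta> (LeTheta a b) \<sigma> \<longleftrightarrow> real (aval a \<sigma>) \<le> \<theta> * real (aval b \<sigma>)"
| "bval ss \<theta> (Neg b) \<sigma> \<longleftrightarrow> \<not> bval ss \<theta> b \<sigma>"
| "bval ss \<theta> (Conj b c) \<sigma> \<longleftrightarrow> bval ss \<theta> b \<sigma> \<and> bval ss \<theta> c \<sigma>"

text \<open>Bit length, with \<open>bits 0 = 1\<close>.\<close>

definition bits :: "nat \<Rightarrow> nat" where
  "bits x = Suc (floor_log x)"

fun acost :: "aexp \<Rightarrow> state \<Rightarrow> nat" where
  "acost (Const k) \<sigma> = bits k"
| "acost (Arr x a) \<sigma> = acost a \<sigma> + bits (aval a \<sigma>) + bits (aval (Arr x a) \<sigma>)"
| "acost (Bin f a b) \<sigma> = acost a \<sigma> + acost b \<sigma> + bits (aval a \<sigma>) + bits (aval b \<sigma>)"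

fun bcost :: "bexp \<Rightarrow> state \<Rightarrow> nat" where
  "bcost (Less a b) \<sigma> = acost a \<sigma> + acost b \<sigma> + bits (aval a \<sigma>) + bits (aval b \<sigma>)"
| "bcost (Equal a b) \<sigma> = acost a \<sigma> + acost b \<sigma> + bits (aval a \<sigma>) + bits (aval b \<sigma>)"
| "bcost (SymEq i p j q) \<sigma> =
     acost i \<sigma> + acost p \<sigma> + acost j \<sigma> + acost q \<sigma> +
     bits (aval i \<sigma>) + bits (aval p \<sigma>) + bits (aval j \<sigma>) + bits (aval q \<sigma>)"
| "bcost (LeTheta a b) \<sigma> = acost a \<sigma> + acost b \<sigma> + bits (aval a \<sigma>) + bits (aval b \<sigma>)"
| "bcost (Neg b) \<sigma> = 1 + bcost b \<sigma>"
| "bcost (Conj b c) \<sigma> = 1 + bcost b \<sigma> + bcost c \<sigma>"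

text \<open>\<open>exec ss \<theta> P \<sigma> t \<sigma>'\<close>: on input strings \<open>ss\<close> and parameter
  \<open>\<theta>\<close>, program \<open>P\<close> started in \<open>\<sigma>\<close> halts in
  \<open>\<sigma>'\<close> at total cost \<open>t\<close>.\<close>

inductive exec :: "'a list list \<Rightarrow> real \<Rightarrow> com \<Rightarrow> state \<Rightarrow> nat \<Rightarrow> state \<Rightarrow> bool"
  for ss :: "'a list list" and \<theta> :: real where
  Skip: "exec ss \<theta> Skip \<sigma> 1 \<sigma>"
| Assign: "exec ss \<theta> (Assign x i a) \<sigma>
     (acost i \<sigma> + acost a \<sigma> + bits (aval i \<sigma>) + bits (aval a \<sigma>))
     (\<sigma>(x := (\<sigma> x)(aval i \<sigma> := aval a \<sigma>)))"
| Seq: "exec ss \<theta> P \<sigma> t \<sigma>' \<Longrightarrow> exec ss \<theta> Q \<sigma>' u \<sigma>'' \<Longrightarrow>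
     exec ss \<theta> (Seq P Q) \<sigma> (t + u) \<sigma>''"
| IfTrue: "bval ss \<theta> b \<sigma> \<Longrightarrow> exec ss \<theta> P \<sigma> t \<sigma>' \<Longrightarrow>
     exec ss \<theta> (If b P Q) \<sigma> (1 + bcost b \<sigma> + t) \<sigma>'"
| IfFalse: "\<not> bval ss \<theta> b \<sigma> \<Longrightarrow> exec ss \<theta> Q \<sigma> t \<sigma>' \<Longrightarrow>
     exec ss \<theta> (If b P Q) \<sigma> (1 + bcost b \<sigma> + t) \<sigma>'"
| WhileFalse: "\<not> bval ss \<theta> b \<sigma> \<Longrightarrow>
     exec ss \<theta> (While b P) \<sigma> (1 + bcost b \<sigma>) \<sigma>"
| WhileTrue: "bval ss \<theta> b \<sigma> \<Longrightarrow> exec ss \<theta> P \<sigma> t \<sigma>' \<Longrightarrow>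
     exec ss \<theta> (While b P) \<sigma>' u \<sigma>'' \<Longrightarrow>
     exec ss \<theta> (While b P) \<sigma> (1 + bcost b \<sigma> + t + u) \<sigma>''"

inductive_cases exec_SkipE: "exec ss \<theta> Skip \<sigma> t \<sigma>'"
inductive_cases exec_AssignE: "exec ss \<theta> (Assign x i a) \<sigma> t \<sigma>'"
inductive_cases exec_SeqE: "exec ss \<theta> (Seq P Q) \<sigma> t \<sigma>'"
inductive_cases exec_IfE: "exec ss \<theta> (If b P Q) \<sigma> t \<sigma>'"
inductive_cases exec_WhileE: "exec ss \<theta> (While b P) \<sigma> t \<sigma>'"

lemma exec_deterministic:
  "exec ss \<theta> P \<sigma> t \<sigma>' \<Longrightarrow> exec ss \<theta> P \<sigma> u \<sigma>'' \<Longrightarrow> u = t \<and> \<sigma>'' = \<sigma>'"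
proof (induction arbitrary: u \<sigma>'' rule: exec.induct)
  case (Skip \<sigma>)
  then show ?case by (auto elim: exec_SkipE)
next
  case (Assign x i a \<sigma>)
  then show ?case by (auto elim: exec_AssignE)
next
  case (Seq P \<sigma> t \<sigma>' Q v \<tau>)
  from Seq.prems obtain t1 \<sigma>1 t2 where "exec ss \<theta> P \<sigma> t1 \<sigma>1" "exec ss \<theta> Q \<sigma>1 t2 \<sigma>''" "u = t1 + t2"
    by (auto elim: exec_SeqE)
  with Seq.IH show ?case by metis
next
  case (IfTrue b \<sigma> P t \<sigma>' Q)
  from IfTrue.prems IfTrue.hyps obtain t1 where "exec ss \<theta> P \<sigma> t1 \<sigma>''" "u = 1 + bcost b \<sigma> + t1"
    by (auto elim: exec_IfE)
  with IfTrue.IH show ?case by metis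
next
  case (IfFalse b \<sigma> Q t \<sigma>' P)
  from IfFalse.prems IfFalse.hyps obtain t1 where "exec ss \<theta> Q \<sigma> t1 \<sigma>''" "u = 1 + bcost b \<sigma> + t1"
    by (auto elim: exec_IfE)
  with IfFalse.IH show ?case by metis
next
  case (WhileFalse b \<sigma> P)
  from WhileFalse.prems WhileFalse.hyps show ?case by (auto elim: exec_WhileE)
next
  case (WhileTrue b \<sigma> P t \<sigma>' v \<tau>)
  from WhileTrue.prems WhileTrue.hyps obtain t1 \<sigma>1 t2 where
    "exec ss \<theta> P \<sigma> t1 \<sigma>1" "exec ss \<theta> (While b P) \<sigma>1 t2 \<sigma>''"
    "u = 1 + bcost b \<sigma> + t1 + t2"
    by (auto elim: exec_WhileE)
  with WhileTrue.IH show ?case by metis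
qed

text \<open>Initially \<open>m\<close> and \<open>n\<close> are stored in the variables of these names and
  all other cells are 0; the output is the final value of the variable \<open>out\<close>.\<close>

definition init_state :: "nat \<Rightarrow> nat \<Rightarrow> state" where
  "init_state m n = (\<lambda>_ _. 0)(''m'' := (\<lambda>_. 0)(0 := m), ''n'' := (\<lambda>_. 0)(0 := n))"

definition runs_with :: "com \<Rightarrow> nat \<Rightarrow> nat \<Rightarrow> 'a list list \<Rightarrow> real \<Rightarrow> nat \<Rightarrow> nat \<Rightarrow> bool" where
  "runs_with P m n ss \<theta> t ans \<longleftrightarrow>
     (\<exists>\<sigma>. exec ss \<theta> P (init_state m n) t \<sigma> \<and> \<sigma> ''out'' 0 = ans)"


section \<open>Soft-O notation\<close>

text \<open>Functions of \<open>m\<close> and \<open>n\<close> bounded by \<open>g\<close> up to a factor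
  \<open>c ^ m * log ^ m n\<close> and a polylogarithmic factor \<open>log ^ k n\<close>, with constants
  \<open>c\<close> and \<open>k\<close> independent of \<open>m\<close> and \<open>n\<close>.  The shift
  \<open>n + 1\<close> keeps the logarithm at least 1 for \<open>n = 1\<close>.\<close>

definition soft_O_m :: "(nat \<Rightarrow> nat \<Rightarrow> real) \<Rightarrow> (nat \<Rightarrow> nat \<Rightarrow> real) set" where
  "soft_O_m g = {f. \<exists>(c::real) (k::nat). c > 0 \<and> (\<forall>m\<ge>1. \<forall>n\<ge>1.
     f m n \<le> (c ^ m * log 2 (real n + 1) ^ m) * log 2 (real n + 1) ^ k * g m n)}"

end

theory Submission
  imports Defs
begin

text \<open>
  Let \<open>s\<close> be the first string and split the others into two (possibly overlapping) groups of
  \<open>h = m div 2\<close> strings.  Call a set of positions of \<open>s\<close> feasible for a group if the symbols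
  there form a common subsequence of \<open>s\<close> and the group.  A maximum-weight feasible set, for weights
  on positions, is found by dynamic programming in about \<open>n ^ (h + 1)\<close> steps, and intersecting
  sets feasible for the two groups gives a common subsequence of all strings.

  If \<open>X\<close> omits \<open>D\<close> positions and is feasible for both groups, intersecting it with a maximum
  feasible set \<open>A\<close> of the first group omits at most \<open>2 * D\<close> positions.  One gains whenever the
  omitted positions of \<open>A\<close> and \<open>X\<close> overlap.  To force an overlap, \<open>3 * n\<close> sets \<open>A j\<close> are
  chosen greedily so as to avoid omitting positions that were omitted before.  If all of them
  overlapped little with \<open>X\<close>, then \<open>X\<close> itself would be a good choice in each round, so the sets
  omitted by the \<open>A j\<close> would be nearly disjoint; by Cauchy-Schwarz there is no room for that in
  \<open>n\<close> positions.  Hence some \<open>A j\<close> loses at most \<open>2 * D - 3 * D\<^sup>2 / (16 * n)\<close> positions, and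
  the best partner of each \<open>A j\<close> in the second group is again found by dynamic programming.
\<close>

section \<open>A program logic with cost bounds\<close>

fun asz :: "aexp \<Rightarrow> nat" where
  "asz (Const k) = 1"
| "asz (Arr x a) = asz a + 2"
| "asz (Bin f a b) = asz a + asz b + 2"

fun abnd :: "nat \<Rightarrow> aexp \<Rightarrow> state \<Rightarrow> bool" where
  "abnd M (Const k) \<sigma> \<longleftrightarrow> k \<le> M"
| "abnd M (Arr x a) \<sigma> \<longleftrightarrow> abnd M a \<sigma> \<and> \<sigma> x (aval a \<sigma>) \<le> M"
| "abnd M (Bin f a b) \<sigma> \<longleftrightarrow> abnd M a \<sigma> \<and> abnd M b \<sigma> \<and> bop_val f (aval a \<sigma>) (aval b \<sigma>) \<le> M"

fun bsz :: "bexp \<Rightarrow> nat" where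
  "bsz (Less a b) = asz a + asz b + 2"
| "bsz (Equal a b) = asz a + asz b + 2"
| "bsz (SymEq i p j q) = asz i + asz p + asz j + asz q + 4"
| "bsz (LeTheta a b) = asz a + asz b + 2"
| "bsz (Neg b) = 1 + bsz b"
| "bsz (Conj b c) = 1 + bsz b + bsz c"

fun bbnd :: "nat \<Rightarrow> bexp \<Rightarrow> state \<Rightarrow> bool" where
  "bbnd M (Less a b) \<sigma> \<longleftrightarrow> abnd M a \<sigma> \<and> abnd M b \<sigma>"
| "bbnd M (Equal a b) \<sigma> \<longleftrightarrow> abnd M a \<sigma> \<and> abnd M b \<sigma>"
| "bbnd M (SymEq i p j q) \<sigma> \<longleftrightarrow> abnd M i \<sigma> \<and> abnd M p \<sigma> \<and> abnd M j \<sigma> \<and> abnd M q \<sigma>"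
| "bbnd M (LeTheta a b) \<sigma> \<longleftrightarrow> abnd M a \<sigma> \<and> abnd M b \<sigma>"
| "bbnd M (Neg b) \<sigma> \<longleftrightarrow> bbnd M b \<sigma>"
| "bbnd M (Conj b c) \<sigma> \<longleftrightarrow> bbnd M b \<sigma> \<and> bbnd M c \<sigma>"

lemma bits_mono: "x \<le> y \<Longrightarrow> bits x \<le> bits y"
  unfolding bits_def by (simp add: floor_log_le_iff)

lemma bits_pos: "1 \<le> bits x"
  by (simp add: bits_def)

lemma abnd_aval: "abnd M a \<sigma> \<Longrightarrow> aval a \<sigma> \<le> M"
  by (cases a) auto

lemma abnd_bits: "abnd M a \<sigma> \<Longrightarrow> bits (aval a \<sigma>) \<le> bits M"
  by (simp add: abnd_aval bits_mono)

lemma acost_le: "abnd M a \<sigma> \<Longrightarrow> acost a \<sigma> \<le> asz a * bits M"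
proof (induction a)
  case (Const k)
  then show ?case by (simp add: bits_mono)
next
  case (Arr x a)
  then show ?case
    using abnd_bits[of M a \<sigma>] bits_mono[of "\<sigma> x (aval a \<sigma>)" M] by (simp add: algebra_simps)
next
  case (Bin f a b)
  then show ?case
    using abnd_bits[of M a \<sigma>] abnd_bits[of M b \<sigma>] by (simp add: algebra_simps)
qed

lemma bcost_le: "bbnd M b \<sigma> \<Longrightarrow> bcost b \<sigma> \<le> bsz b * bits M"
proof (induction b)
  case (Less a b)
  then show ?case
    using abnd_bits[of M a \<sigma>] abnd_bits[of M b \<sigma>] acost_le[of M a \<sigma>] acost_le[of M b \<sigma>]
    by (simp add: algebra_simps)
next
  case (Equal a b)
  then show ?case
    using abnd_bits[of M a \<sigma>] abnd_bits[of M b \<sigma>] acost_le[of M a \<sigma>] acost_le[of M b \<sigma>]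
    by (simp add: algebra_simps)
next
  case (SymEq i p j q)
  then show ?case
    using abnd_bits[of M i \<sigma>] abnd_bits[of M p \<sigma>] abnd_bits[of M j \<sigma>] abnd_bits[of M q \<sigma>]
      acost_le[of M i \<sigma>] acost_le[of M p \<sigma>] acost_le[of M j \<sigma>] acost_le[of M q \<sigma>]
    by (simp add: algebra_simps)
next
  case (LeTheta a b)
  then show ?case
    using abnd_bits[of M a \<sigma>] abnd_bits[of M b \<sigma>] acost_le[of M a \<sigma>] acost_le[of M b \<sigma>]
    by (simp add: algebra_simps)
next
  case (Neg b)
  then show ?case using bits_pos[of M] by simp
next
  case (Conj b c)
  then show ?case using bits_pos[of M] by (simp add: algebra_simps)
qed

fun writes :: "com \<Rightarrow> string set" where
  "writes Skip = {}"
| "writes (Assign x i a) = {x}"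
| "writes (Seq P Q) = writes P \<union> writes Q"
| "writes (If b P Q) = writes P \<union> writes Q"
| "writes (While b P) = writes P"

lemma exec_frame: "exec ss \<theta> P \<sigma> t \<sigma>' \<Longrightarrow> x \<notin> writes P \<Longrightarrow> \<sigma>' x = \<sigma> x"
  by (induction rule: exec.induct) auto

text \<open>Costs are counted in units of \<open>bits M\<close>, where \<open>M\<close> bounds every number and address that
  the program handles.\<close>

definition wp :: "'a list list \<Rightarrow> real \<Rightarrow> nat \<Rightarrow> com \<Rightarrow> nat \<Rightarrow> (state \<Rightarrow> bool) \<Rightarrow> state \<Rightarrow> bool" where
  "wp ss \<theta> M P T Q \<sigma> \<longleftrightarrow> (\<exists>t \<sigma>'. exec ss \<theta> P \<sigma> t \<sigma>' \<and> t \<le> T * bits M \<and> Q \<sigma>')"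

lemma wp_conseq:
  "wp ss \<theta> M P T Q \<sigma> \<Longrightarrow> T \<le> T' \<Longrightarrow> (\<And>\<sigma>'. Q \<sigma>' \<Longrightarrow> Q' \<sigma>') \<Longrightarrow> wp ss \<theta> M P T' Q' \<sigma>"
  unfolding wp_def by (meson le_trans mult_le_mono1)

lemma wp_frame:
  "wp ss \<theta> M P T Q \<sigma> \<Longrightarrow> wp ss \<theta> M P T (\<lambda>\<sigma>'. Q \<sigma>' \<and> (\<forall>x. x \<notin> writes P \<longrightarrow> \<sigma>' x = \<sigma> x)) \<sigma>"
  unfolding wp_def using exec_frame by metis

lemma wp_Seq:
  assumes "wp ss \<theta> M P T (\<lambda>\<sigma>'. wp ss \<theta> M Q U R \<sigma>') \<sigma>"
  shows "wp ss \<theta> M (Seq P Q) (T + U) R \<sigma>"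
  using assms unfolding wp_def by (fastforce intro: exec.Seq simp: add_mult_distrib)

lemma wp_Seq':
  assumes "wp ss \<theta> M P T Q \<sigma>" "\<And>\<sigma>'. Q \<sigma>' \<Longrightarrow> wp ss \<theta> M P' T' R \<sigma>'"
  shows "wp ss \<theta> M (Seq P P') (T + T') R \<sigma>"
  by (rule wp_Seq, rule wp_conseq[OF assms(1)]) (auto intro: assms(2))

fun tm :: "com \<Rightarrow> nat" where
  "tm Skip = 1"
| "tm (Assign x i a) = asz i + asz a + 2"
| "tm (Seq P Q) = tm P + tm Q"
| "tm (If b P Q) = 1 + bsz b + (tm P + tm Q)"
| "tm (While b P) = 0"

text \<open>Loop-free programs only: \<open>tm\<close> and \<open>vc\<close> have dummy values on \<open>While\<close>.\<close>

fun vc :: "'a list list \<Rightarrow> real \<Rightarrow> nat \<Rightarrow> com \<Rightarrow> (state \<Rightarrow> bool) \<Rightarrow> state \<Rightarrow> bool" where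
  "vc ss \<theta> M Skip Q \<sigma> \<longleftrightarrow> Q \<sigma>"
| "vc ss \<theta> M (Assign x i a) Q \<sigma> \<longleftrightarrow>
     abnd M i \<sigma> \<and> abnd M a \<sigma> \<and> Q (\<sigma>(x := (\<sigma> x)(aval i \<sigma> := aval a \<sigma>)))"
| "vc ss \<theta> M (Seq P R) Q \<sigma> \<longleftrightarrow> vc ss \<theta> M P (vc ss \<theta> M R Q) \<sigma>"
| "vc ss \<theta> M (If b P R) Q \<sigma> \<longleftrightarrow>
     bbnd M b \<sigma> \<and> (if bval ss \<theta> b \<sigma> then vc ss \<theta> M P Q \<sigma> else vc ss \<theta> M R Q \<sigma>)"
| "vc ss \<theta> M (While b P) Q \<sigma> \<longleftrightarrow> False"

lemma vc_sound: "vc ss \<theta> M P Q \<sigma> \<Longrightarrow> wp ss \<theta> M P (tm P) Q \<sigma>"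
proof (induction P arbitrary: Q \<sigma>)
  case Skip
  then show ?case using exec.Skip bits_pos[of M] by (fastforce simp: wp_def)
next
  case (Assign x i a)
  then show ?case
    using abnd_bits[of M i \<sigma>] abnd_bits[of M a \<sigma>] acost_le[of M i \<sigma>] acost_le[of M a \<sigma>]
    by (force simp: wp_def algebra_simps intro!: exI conjI exec.Assign)
next
  case (Seq P R)
  from Seq.prems have "vc ss \<theta> M P (vc ss \<theta> M R Q) \<sigma>" by simp
  from Seq.IH(1)[OF this] have "wp ss \<theta> M P (tm P) (\<lambda>\<sigma>'. wp ss \<theta> M R (tm R) Q \<sigma>') \<sigma>"
    by (rule wp_conseq) (auto intro: Seq.IH(2))
  then show ?case by (simp add: wp_Seq)
next
  case (If b P R)
  have c: "bcost b \<sigma> \<le> bsz b * bits M" using If.prems by (simp add: bcost_le)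
  show ?case
  proof (cases "bval ss \<theta> b \<sigma>")
    case True
    then have "wp ss \<theta> M P (tm P) Q \<sigma>" using If.prems If.IH(1) by simp
    then obtain t \<sigma>' where "exec ss \<theta> P \<sigma> t \<sigma>'" "t \<le> tm P * bits M" "Q \<sigma>'" by (auto simp: wp_def)
    moreover from this have "1 + bcost b \<sigma> + t \<le> tm (If b P R) * bits M"
      using c bits_pos[of M] by (simp add: algebra_simps)
    ultimately show ?thesis unfolding wp_def using exec.IfTrue[OF True] by blast
  next
    case False
    then have "wp ss \<theta> M R (tm R) Q \<sigma>" using If.prems If.IH(2) by simp
    then obtain t \<sigma>' where "exec ss \<theta> R \<sigma> t \<sigma>'" "t \<le> tm R * bits M" "Q \<sigma>'" by (auto simp: wp_def)
    moreover from this have "1 + bcost b \<sigma> + t \<le> tm (If b P R) * bits M"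
      using c bits_pos[of M] by (simp add: algebra_simps)
    ultimately show ?thesis unfolding wp_def using exec.IfFalse[OF False] by blast
  qed
qed simp

lemma wp_While:
  fixes \<mu> :: "state \<Rightarrow> nat"
  assumes step: "\<And>\<sigma>. I \<sigma> \<Longrightarrow> bval ss \<theta> b \<sigma> \<Longrightarrow> wp ss \<theta> M P T (\<lambda>\<sigma>'. I \<sigma>' \<and> \<mu> \<sigma>' < \<mu> \<sigma>) \<sigma>"
    and bnd: "\<And>\<sigma>. I \<sigma> \<Longrightarrow> bbnd M b \<sigma>"
    and "I \<sigma>" "\<mu> \<sigma> \<le> N"
  shows "wp ss \<theta> M (While b P) (N * (T + bsz b + 1) + bsz b + 1) (\<lambda>\<sigma>'. I \<sigma>' \<and> \<not> bval ss \<theta> b \<sigma>') \<sigma>"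
  using assms(3,4)
proof (induction N arbitrary: \<sigma> rule: less_induct)
  case (less N)
  have c: "bcost b \<sigma> \<le> bsz b * bits M" using less.prems bnd by (simp add: bcost_le)
  show ?case
  proof (cases "bval ss \<theta> b \<sigma>")
    case True
    then obtain t \<sigma>' where 1: "exec ss \<theta> P \<sigma> t \<sigma>'" "t \<le> T * bits M" "I \<sigma>'" "\<mu> \<sigma>' < \<mu> \<sigma>"
      using step[OF less.prems(1)] by (auto simp: wp_def)
    have lt: "N - 1 < N" "\<mu> \<sigma>' \<le> N - 1" using 1 less.prems by auto
    from less.IH[OF lt(1) 1(3) lt(2)] obtain u \<sigma>'' where
      2: "exec ss \<theta> (While b P) \<sigma>' u \<sigma>''" "u \<le> ((N - 1) * (T + bsz b + 1) + bsz b + 1) * bits M"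
        "I \<sigma>''" "\<not> bval ss \<theta> b \<sigma>''" by (auto simp: wp_def)
    have "1 + bcost b \<sigma> + t + u \<le> bits M + bsz b * bits M + T * bits M
        + ((N - 1) * (T + bsz b + 1) + bsz b + 1) * bits M"
      using c 1 2 bits_pos[of M] by linarith
    also have "\<dots> = (N * (T + bsz b + 1) + bsz b + 1) * bits M"
      using lt by (cases N) (auto simp: algebra_simps)
    finally show ?thesis unfolding wp_def using exec.WhileTrue[OF True 1(1) 2(1)] 2 by blast
  next
    case False
    have "1 + bcost b \<sigma> \<le> (bsz b + 1) * bits M" using c bits_pos[of M] by (simp add: algebra_simps)
    also have "\<dots> \<le> (N * (T + bsz b + 1) + bsz b + 1) * bits M" by (intro mult_le_mono1) simp
    finally show ?thesis unfolding wp_def using exec.WhileFalse[OF False] less.prems False by blast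
  qed
qed

lemma wp_For:
  assumes step: "\<And>k \<sigma>. k < N \<Longrightarrow> I k \<sigma> \<Longrightarrow> wp ss \<theta> M P T (I (Suc k)) \<sigma>"
    and bnd: "\<And>k \<sigma>. k \<le> N \<Longrightarrow> I k \<sigma> \<Longrightarrow> bbnd M b \<sigma> \<and> (bval ss \<theta> b \<sigma> \<longleftrightarrow> k < N)"
    and "I 0 \<sigma>"
  shows "wp ss \<theta> M (While b P) (N * (T + bsz b + 1) + bsz b + 1) (I N) \<sigma>"
proof -
  have "\<exists>t \<sigma>'. exec ss \<theta> (While b P) \<sigma> t \<sigma>' \<and>
      t \<le> ((N - k) * (T + bsz b + 1) + bsz b + 1) * bits M \<and> I N \<sigma>'" if "k \<le> N" "I k \<sigma>" for k \<sigma>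
    using that
  proof (induction k arbitrary: \<sigma> rule: inc_induct)
    case base
    have c: "bcost b \<sigma> \<le> bsz b * bits M" using base bnd[of N \<sigma>] by (simp add: bcost_le)
    have f: "\<not> bval ss \<theta> b \<sigma>" using bnd[of N \<sigma>] base by simp
    have "1 + bcost b \<sigma> \<le> ((N - N) * (T + bsz b + 1) + bsz b + 1) * bits M"
      using c bits_pos[of M] by (simp add: algebra_simps)
    then show ?case using exec.WhileFalse[OF f] base by blast
  next
    case (step k)
    have c: "bcost b \<sigma> \<le> bsz b * bits M" using step.prems step.hyps bnd[of k \<sigma>] by (simp add: bcost_le)
    have f: "bval ss \<theta> b \<sigma>" using step.prems step.hyps bnd[of k \<sigma>] by simp
    obtain t \<sigma>' where 1: "exec ss \<theta> P \<sigma> t \<sigma>'" "t \<le> T * bits M" "I (Suc k) \<sigma>'"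
      using assms(1)[of k \<sigma>] step.prems step.hyps by (auto simp: wp_def)
    from step.IH[OF 1(3)] obtain u \<sigma>'' where
      2: "exec ss \<theta> (While b P) \<sigma>' u \<sigma>''" "u \<le> ((N - Suc k) * (T + bsz b + 1) + bsz b + 1) * bits M"
        "I N \<sigma>''" by auto
    have "1 + bcost b \<sigma> + t + u \<le> bits M + bsz b * bits M + T * bits M
        + ((N - Suc k) * (T + bsz b + 1) + bsz b + 1) * bits M"
      using c 1 2 bits_pos[of M] by linarith
    also have "\<dots> = (Suc (N - Suc k) * (T + bsz b + 1) + bsz b + 1) * bits M"
      by (auto simp: algebra_simps)
    also have "Suc (N - Suc k) = N - k" using step.hyps by simp
    finally show ?case using exec.WhileTrue[OF f 1(1) 2(1)] 2 by blast
  qed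
  from this[of 0 \<sigma>] show ?thesis using assms(3) by (simp add: wp_def)
qed

section \<open>Greedy rounds\<close>

lemma sum_prefix_sums:
  fixes f :: "nat \<Rightarrow> real"
  shows "(\<Sum>j<K. \<Sum>l<j. f l) = (\<Sum>l<K. real (K - 1 - l) * f l)"
proof (induction K)
  case (Suc K)
  have "real (K - l) * f l = real (K - 1 - l) * f l + f l" if "l < K" for l
  proof -
    have "K - l = Suc (K - 1 - l)" using that by simp
    then show ?thesis by (simp only: of_nat_Suc) (simp only: distrib_right mult_1)
  qed
  then have "(\<Sum>l<K. real (K - l) * f l) = (\<Sum>l<K. real (K - 1 - l) * f l) + (\<Sum>l<K. f l)"
    by (simp add: sum.distrib del: of_nat_diff)
  with Suc show ?case by (simp del: of_nat_diff)
qed simp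

lemma sum_upto_le_half_square:
  fixes g :: real
  assumes "g \<ge> 0"
  shows "(\<Sum>j<K. real j * g) \<le> real K * real K * g / 2"
proof (induction K)
  case (Suc K)
  have "real (Suc K) * real (Suc K) * g / 2 = real K * real K * g / 2 + real K * g + g / 2"
    by (simp add: field_simps)
  then show ?case using Suc assms by simp
qed simp

lemma square_sum_le_card_mult:
  fixes f :: "'b \<Rightarrow> real"
  assumes "finite U"
  shows "(\<Sum>i\<in>U. f i)\<^sup>2 \<le> real (card U) * (\<Sum>i\<in>U. (f i)\<^sup>2)"
proof (cases "U = {}")
  case False
  then have n0: "real (card U) > 0" using assms by (simp add: card_gt_0_iff)
  define S where "S = (\<Sum>i\<in>U. f i)"
  define c where "c = S / real (card U)"
  have "0 \<le> (\<Sum>i\<in>U. (f i - c)\<^sup>2)" by (simp add: sum_nonneg)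
  also have "\<dots> = (\<Sum>i\<in>U. (f i)\<^sup>2) - 2 * c * S + real (card U) * c\<^sup>2"
    by (simp add: power2_diff sum.distrib sum_subtractf sum_distrib_left sum_distrib_right mult_ac S_def)
  also have "\<dots> = (\<Sum>i\<in>U. (f i)\<^sup>2) - S\<^sup>2 / real (card U)"
    using n0 by (simp add: c_def power2_eq_square)
  finally show ?thesis using n0 unfolding S_def by (simp add: field_simps)
qed simp

text \<open>The weight \<open>K - 1 - j\<close> in round \<open>j\<close> acts as a Lagrange multiplier for the size of \<open>A j\<close>.
  It is chosen such that, after summing the greedy inequalities over all rounds, the unknown sizes
  cancel (\<open>sum_prefix_sums\<close>).\<close>

lemma greedy_rounds:
  fixes n K :: nat and A :: "nat \<Rightarrow> nat set" and F :: "nat set set"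
  defines "K \<equiv> 3 * n"
  defines "C \<equiv> \<lambda>j i. card {l. l < j \<and> i \<notin> A l}"
  assumes n: "n \<ge> 1"
    and F: "\<And>X. X \<in> F \<Longrightarrow> X \<subseteq> {..<n}"
    and A: "\<And>j. j < K \<Longrightarrow> A j \<in> F"
    and greedy: "\<And>j X. j < K \<Longrightarrow> X \<in> F \<Longrightarrow>
      (\<Sum>i\<in>X. (K - 1 - j) + C j i) \<le> (\<Sum>i\<in>A j. (K - 1 - j) + C j i)"
    and X: "X \<in> F"
  defines "D \<equiv> n - card X"
  shows "\<exists>j<K. 16 * n * (n - card (X \<inter> A j)) + 3 * D\<^sup>2 \<le> 32 * n * D"
proof (rule ccontr)
  assume "\<not> ?thesis"
  then have bad: "32 * n * D < 16 * n * (n - card (X \<inter> A j)) + 3 * D\<^sup>2" if "j < K" for j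
    using that by force
  define U where "U = {..<n}"
  have fU: "finite U" "card U = n" by (auto simp: U_def)
  have XU: "X \<subseteq> U" and AU: "j < K \<Longrightarrow> A j \<subseteq> U" for j using F X A by (auto simp: U_def)
  have finX: "finite X" using XU fU finite_subset by blast
  have cX: "card (U - X) = D" using XU fU by (simp add: D_def card_Diff_subset finX)
  define a where "a j = card (U - A j)" for j
  define ov where "ov j = card ((U - A j) \<inter> (U - X))" for j
  define g where "g = 3 * real D ^ 2 / (16 * real n)"
  have n0: "real n > 0" using n by simp
  have loss: "real (n - card (X \<inter> A j)) = real (a j) + real D - real (ov j)" if "j < K" for j
  proof -
    have "U - X \<inter> A j = (U - A j) \<union> (U - X)" by auto
    then have "card (U - X \<inter> A j) + ov j = a j + D"
      using card_Un_Int[of "U - A j" "U - X"] fU cX by (simp add: a_def ov_def)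
    moreover have "card (U - X \<inter> A j) = n - card (X \<inter> A j)"
      using XU fU by (subst card_Diff_subset) (auto intro: finite_subset[OF _ finX])
    ultimately show ?thesis by linarith
  qed
  have ovlt: "real (ov j) < real (a j) - real D + g" if "j < K" for j
  proof -
    have "real (32 * n * D) < real (16 * n * (n - card (X \<inter> A j)) + 3 * D\<^sup>2)"
      using bad[OF that] by linarith
    then have "32 * real n * real D < 16 * real n * (real (a j) + real D - real (ov j)) + 3 * (real D)\<^sup>2"
      using loss[OF that] by (simp del: of_nat_diff)
    then show ?thesis using n0 by (simp add: g_def field_simps)
  qed
  have Dn: "real D \<le> real n" by (simp add: D_def)
  have gD: "g \<le> 3 * real D / 16"
  proof -
    have "real D * real D \<le> real D * real n" using Dn by (intro mult_left_mono) auto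
    then show ?thesis using n0 by (simp add: g_def field_simps power2_eq_square)
  qed
  have g0: "g \<ge> 0" by (simp add: g_def)
  have a_low: "real (a j) \<ge> 13 * real D / 16" if "j < K" for j
    using ovlt[OF that] gD by linarith
  have a1: "real (a j) \<ge> 1" if "j < K" for j
  proof -
    have "ov j \<le> a j" unfolding ov_def a_def using fU by (intro card_mono) auto
    moreover have "D \<ge> 1 \<Longrightarrow> a j \<noteq> 0" using a_low[OF that] by auto
    moreover have "D = 0 \<Longrightarrow> a j \<noteq> 0" using ovlt[OF that] by (auto simp: g_def)
    ultimately have "a j \<noteq> 0" by (cases "D = 0") auto
    then show ?thesis by simp
  qed
  have Csum: "C j i = (\<Sum>l<j. if i \<notin> A l then 1 else 0)" for j i
    by (simp add: C_def sum.If_cases Int_def)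
  have sumC: "(\<Sum>i\<in>Y. C j i) = (\<Sum>l<j. card (Y - A l))" if "Y \<subseteq> U" for Y j
  proof -
    have fY: "finite Y" using that fU finite_subset by blast
    have "(\<Sum>i\<in>Y. C j i) = (\<Sum>l<j. \<Sum>i\<in>Y. if i \<notin> A l then 1 else 0)"
      unfolding Csum by (rule sum.swap)
    also have "\<dots> = (\<Sum>l<j. card (Y - A l))"
      using fY by (intro sum.cong refl) (simp add: sum.If_cases Diff_eq Int_def)
    finally show ?thesis .
  qed
  have step: "real (K - 1 - j) * (real (a j) - real D) + (\<Sum>i\<in>U - A j. real (C j i))
       \<le> (\<Sum>l<j. real (a l) - real D + g)" if j: "j < K" for j
  proof -
    have tot: "(\<Sum>i\<in>Y. (K - 1 - j) + C j i) + (\<Sum>i\<in>U - Y. (K - 1 - j) + C j i) = (\<Sum>i\<in>U. (K - 1 - j) + C j i)"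
      if "Y \<subseteq> U" for Y using sum.subset_diff[OF that fU(1)] by (metis add.commute)
    have "(\<Sum>i\<in>U - A j. (K - 1 - j) + C j i) \<le> (\<Sum>i\<in>U - X. (K - 1 - j) + C j i)"
      using tot[OF XU] tot[OF AU[OF j]] greedy[OF j X] by linarith
    then have "(K - 1 - j) * a j + (\<Sum>i\<in>U - A j. C j i) \<le> (K - 1 - j) * D + (\<Sum>i\<in>U - X. C j i)"
      by (simp add: sum.distrib a_def cX mult.commute)
    also have "(\<Sum>i\<in>U - X. C j i) = (\<Sum>l<j. ov l)"
      by (subst sumC) (auto simp: ov_def Int_def Diff_eq intro!: sum.cong arg_cong[where f=card])
    finally have "real ((K - 1 - j) * a j + (\<Sum>i\<in>U - A j. C j i)) \<le> real ((K - 1 - j) * D + (\<Sum>l<j. ov l))"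
      by (simp only: of_nat_le_iff)
    then have "real (K - 1 - j) * real (a j) + (\<Sum>i\<in>U - A j. real (C j i))
        \<le> real (K - 1 - j) * real D + (\<Sum>l<j. real (ov l))"
      by (simp only: of_nat_add of_nat_mult of_nat_sum)
    moreover have "(\<Sum>l<j. real (ov l)) \<le> (\<Sum>l<j. real (a l) - real D + g)"
    proof (rule sum_mono)
      fix l assume "l \<in> {..<j}"
      then show "real (ov l) \<le> real (a l) - real D + g" using ovlt[of l] j by simp
    qed
    ultimately show ?thesis unfolding right_diff_distrib by linarith
  qed
  define S where "S = (\<Sum>j<K. real (a j))"
  have quad: "(\<Sum>j<k. \<Sum>i\<in>U - A j. real (C j i)) = (\<Sum>i\<in>U. real (C k i) * (real (C k i) - 1) / 2)" for k
  proof (induction k)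
    case 0
    then show ?case by (simp add: C_def)
  next
    case (Suc k)
    have CS: "C (Suc k) i = C k i + (if i \<in> A k then 0 else 1)" for i
      by (simp add: Csum)
    have "(\<Sum>i\<in>U - A k. real (C k i)) = (\<Sum>i\<in>U. if i \<in> A k then 0 else real (C k i))"
      using fU by (subst sum.mono_neutral_cong_right[of U "U - A k"]) auto
    with Suc have "(\<Sum>j<Suc k. \<Sum>i\<in>U - A j. real (C j i)) =
        (\<Sum>i\<in>U. real (C k i) * (real (C k i) - 1) / 2 + (if i \<in> A k then 0 else real (C k i)))"
      by (simp add: sum.distrib)
    also have "\<dots> = (\<Sum>i\<in>U. real (C (Suc k) i) * (real (C (Suc k) i) - 1) / 2)"
      by (intro sum.cong) (auto simp: CS field_simps)
    finally show ?case .
  qed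
  have "(\<Sum>j<K. real (K - 1 - j) * (real (a j) - real D) + (\<Sum>i\<in>U - A j. real (C j i)))
     \<le> (\<Sum>j<K. \<Sum>l<j. real (a l) - real D + g)"
    by (rule sum_mono) (use step in blast)
  also have "\<dots> = (\<Sum>j<K. real (K - 1 - j) * (real (a j) - real D)) + (\<Sum>j<K. real j * g)"
    unfolding sum.distrib sum_prefix_sums[symmetric] by simp
  finally have "(\<Sum>i\<in>U. real (C K i) * (real (C K i) - 1) / 2) \<le> (\<Sum>j<K. real j * g)"
    unfolding sum.distrib quad by simp
  also have "\<dots> \<le> real K * real K * g / 2" by (rule sum_upto_le_half_square[OF g0])
  finally have 1: "(\<Sum>i\<in>U. (real (C K i))\<^sup>2) - (\<Sum>i\<in>U. real (C K i)) \<le> (real K)\<^sup>2 * g"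
    by (simp add: sum_divide_distrib[symmetric] algebra_simps power2_eq_square sum_subtractf)
  have 2: "(\<Sum>i\<in>U. real (C K i)) = S"
  proof -
    have "(\<Sum>i\<in>U. C K i) = (\<Sum>l<K. a l)" using sumC[of U K] by (simp add: a_def)
    then show ?thesis unfolding S_def by (metis of_nat_sum)
  qed
  have 3: "S\<^sup>2 \<le> real n * (\<Sum>i\<in>U. (real (C K i))\<^sup>2)"
    using square_sum_le_card_mult[OF fU(1), of "\<lambda>i. real (C K i)"] unfolding 2 fU(2) .
  have S1: "S \<ge> 3 * real n"
    using sum_bounded_below[of "{..<K}" 1 "\<lambda>j. real (a j)"] a1 by (simp add: S_def K_def)
  have S2: "S \<ge> 39 / 16 * (real n * real D)"
    using sum_bounded_below[of "{..<K}" "13 * real D / 16" "\<lambda>j. real (a j)"] a_low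
    by (simp add: S_def K_def)
  have "real n * S \<le> S / 3 * S" using S1 n0 by (intro mult_right_mono) auto
  then have S3: "real n * S \<le> S\<^sup>2 / 3" by (simp add: power2_eq_square)
  have S4: "(39 / 16 * (real n * real D))\<^sup>2 \<le> S\<^sup>2"
    using S2 n0 by (intro power_mono) auto
  have "(\<Sum>i\<in>U. (real (C K i))\<^sup>2) \<le> S + 27 / 16 * (real n * (real D)\<^sup>2)"
    using 1 n0 unfolding 2 by (simp add: K_def g_def field_simps power2_eq_square)
  then have "real n * (\<Sum>i\<in>U. (real (C K i))\<^sup>2) \<le> real n * (S + 27 / 16 * (real n * (real D)\<^sup>2))"
    using n0 by (intro mult_left_mono) auto
  then have "S\<^sup>2 \<le> S\<^sup>2 / 3 + 27 / 16 * (real n * real D)\<^sup>2"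
    using 3 S3 by (simp add: algebra_simps power2_eq_square)
  moreover have "S\<^sup>2 > 0" using S1 n0 by simp
  ultimately show False using S4 unfolding power_mult_distrib[of "39 / 16"]
    by (simp add: power2_eq_square)
qed

section \<open>Weighted common subsequences by dynamic programming\<close>

definition dig :: "nat \<Rightarrow> nat \<Rightarrow> nat \<Rightarrow> nat" where
  "dig B x i = x div B ^ i mod B"

lemma dig_0: "dig B x 0 = x mod B"
  by (simp add: dig_def)

lemma dig_Suc: "dig B x (Suc i) = dig B (x div B) i"
  by (simp add: dig_def div_mult2_eq)

lemma dig_less: "0 < B \<Longrightarrow> dig B x i < B"
  by (simp add: dig_def)

lemma digit_sum_shift:
  "(\<Sum>i<Suc k. p i * B ^ i) = p 0 + B * (\<Sum>i<k. p (Suc i) * B ^ i)" for B :: nat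
  by (simp add: sum.lessThan_Suc_shift sum_distrib_left mult_ac del: sum.lessThan_Suc)

lemma dig_digit_sum:
  assumes "\<And>i. i < k \<Longrightarrow> p i < B" "j < k"
  shows "dig B (\<Sum>i<k. p i * B ^ i) j = p j"
  using assms
proof (induction k arbitrary: p j)
  case (Suc k)
  have p0: "p 0 < B" using Suc.prems by simp
  then have dv: "(p 0 + B * y) div B = y" for y by simp
  show ?case
  proof (cases j)
    case 0
    then show ?thesis unfolding digit_sum_shift using p0 by (simp add: dig_0)
  next
    case (Suc j')
    then show ?thesis unfolding digit_sum_shift
      using p0 Suc.IH[of "\<lambda>i. p (Suc i)" j'] Suc.prems by (simp add: dig_Suc Suc dv)
  qed
qed simp

lemma digit_sum_dig:
  assumes "x < B ^ k"
  shows "(\<Sum>i<k. dig B x i * B ^ i) = x"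
  using assms
proof (induction k arbitrary: x)
  case (Suc k)
  have "x div B < B ^ k" using Suc.prems by (simp add: less_mult_imp_div_less mult.commute)
  then show ?case unfolding digit_sum_shift using Suc.IH[of "x div B"] by (simp add: dig_0 dig_Suc)
qed simp

lemma power_le_if_dig_pos:
  assumes "0 < dig B x i"
  shows "B ^ i \<le> x"
  using assms by (intro leI) (auto simp: dig_def)

lemma dig_diff_power:
  assumes "x < B ^ k" "i < k" "j < k" "0 < dig B x i" and B: "0 < B"
  shows "dig B (x - B ^ i) j = (if j = i then dig B x i - 1 else dig B x j)"
proof -
  define p where "p = (dig B x)(i := dig B x i - 1)"
  have pl: "p j < B" for j using dig_less[OF B, of x j] by (auto simp: p_def less_imp_diff_less)
  have "x = (\<Sum>i<k. dig B x i * B ^ i)" using digit_sum_dig[OF assms(1)] by simp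
  also have "\<dots> = (\<Sum>l<k. p l * B ^ l + (if l = i then B ^ i else 0))"
  proof (rule sum.cong)
    fix l
    have "dig B x i * B ^ i = (dig B x i - 1) * B ^ i + B ^ i"
      using assms(4) by (cases "dig B x i") auto
    then show "dig B x l * B ^ l = p l * B ^ l + (if l = i then B ^ i else 0)"
      by (auto simp: p_def)
  qed simp
  also have "\<dots> = (\<Sum>l<k. p l * B ^ l) + B ^ i"
    using assms(2) by (simp add: sum.distrib)
  finally have "x - B ^ i = (\<Sum>l<k. p l * B ^ l)" by simp
  then have "dig B (x - B ^ i) j = p j" using dig_digit_sum[of k p B j] pl assms(3) by simp
  then show ?thesis by (simp add: p_def)
qed

lemma dig_diff_repunit:
  assumes "x < B ^ k" "j < k" "\<And>i. i < k \<Longrightarrow> 0 < dig B x i" and B: "0 < B"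
  shows "dig B (x - (\<Sum>i<k. B ^ i)) j = dig B x j - 1" "(\<Sum>i<k. B ^ i) \<le> x"
proof -
  have pl: "dig B x l - 1 < B" for l using dig_less[OF B, of x l] by (auto simp: less_imp_diff_less)
  have "x = (\<Sum>i<k. dig B x i * B ^ i)" using digit_sum_dig[OF assms(1)] by simp
  also have "\<dots> = (\<Sum>l<k. (dig B x l - 1) * B ^ l + B ^ l)"
  proof (rule sum.cong)
    fix l assume "l \<in> {..<k}"
    then show "dig B x l * B ^ l = (dig B x l - 1) * B ^ l + B ^ l"
      using assms(3)[of l] by (cases "dig B x l") auto
  qed simp
  finally have e: "x = (\<Sum>l<k. (dig B x l - 1) * B ^ l) + (\<Sum>i<k. B ^ i)"
    by (simp add: sum.distrib)
  then show "(\<Sum>i<k. B ^ i) \<le> x" by linarith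
  from e have "x - (\<Sum>i<k. B ^ i) = (\<Sum>l<k. (dig B x l - 1) * B ^ l)" by linarith
  then show "dig B (x - (\<Sum>i<k. B ^ i)) j = dig B x j - 1"
    using dig_digit_sum[of k "\<lambda>l. dig B x l - 1" B j] pl assms(2) by simp
qed

lemma dig_top:
  assumes "j < k"
  shows "dig (Suc n) (Suc n ^ k - 1) j = n"
proof -
  have "(\<Sum>i<k. n * Suc n ^ i) + 1 = Suc n ^ k"
    by (induction k) auto
  then have "Suc n ^ k - 1 = (\<Sum>i<k. n * Suc n ^ i)" by linarith
  then show ?thesis using dig_digit_sum[of k "\<lambda>_. n" "Suc n" j] assms by simp
qed

lemma subseq_nths_mono: "A \<subseteq> B \<Longrightarrow> subseq (nths xs A) (nths xs B)"
proof (induction xs arbitrary: A B)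
  case (Cons x xs)
  have "{j. Suc j \<in> A} \<subseteq> {j. Suc j \<in> B}" using Cons.prems by auto
  from Cons.IH[OF this] show ?case using Cons.prems by (auto simp: nths_Cons)
qed simp

lemma nths_insert_last:
  assumes "A \<subseteq> {..<p}" "p < length xs"
  shows "nths xs (insert p A) = nths xs A @ [xs ! p]"
  using assms
proof (induction xs arbitrary: p A)
  case (Cons x xs)
  show ?case
  proof (cases p)
    case 0
    then show ?thesis using Cons.prems by (simp add: nths_Cons)
  next
    case (Suc q)
    have "{j. Suc j \<in> insert p A} = insert q {j. Suc j \<in> A}" using Suc by auto
    moreover have "{j. Suc j \<in> A} \<subseteq> {..<q}" using Suc Cons.prems by auto
    ultimately show ?thesis using Cons.IH[of "{j. Suc j \<in> A}" q] Cons.prems Suc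
      by (simp add: nths_Cons)
  qed
qed simp

lemma length_nths_subset:
  assumes "A \<subseteq> {..<length xs}"
  shows "length (nths xs A) = card A"
proof -
  have "{i. i < length xs \<and> i \<in> A} = A" using assms by auto
  then show ?thesis by (simp add: length_nths)
qed

lemma subseq_append_single_last:
  assumes "subseq (u @ [c]) (v @ [d])" "\<not> subseq (u @ [c]) v"
  shows "c = d \<and> subseq u v"
proof -
  from assms(1) obtain v1 v2 where v: "v @ [d] = v1 @ v2" "subseq u v1" "subseq [c] v2"
    using list_emb_appendD by blast
  show ?thesis
  proof (cases v2 rule: rev_cases)
    case Nil
    then show ?thesis using v by simp
  next
    case (snoc v3 e)
    then have e: "e = d" "v = v1 @ v3" using v by auto
    have "c \<notin> set v3"
    proof
      assume "c \<in> set v3"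
      then have "subseq [c] v3" by (simp add: subseq_singleton_left)
      then show False using v e assms(2) by (simp add: list_emb_append_mono)
    qed
    then have "c = d" using v(3) snoc e by (simp add: subseq_singleton_left)
    moreover have "subseq u v" using list_emb_prefix[of "(=)" u v1 v3] v(2) e by simp
    ultimately show ?thesis ..
  qed
qed

text \<open>The \<open>i\<close>-th coordinate of the grid belongs to the first string if \<open>i = 0\<close> and to string
  \<open>off + i\<close> otherwise; the truncated subtraction saves the program a case distinction.\<close>

definition sidx :: "nat \<Rightarrow> nat \<Rightarrow> nat" where
  "sidx off i = i + off * (1 - (1 - i))"

lemma sidx_simps [simp]: "sidx off 0 = 0" "0 < i \<Longrightarrow> sidx off i = off + i"
  by (auto simp: sidx_def)

locale grid =
  fixes ss :: "'a list list" and n h off :: nat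
  assumes n: "1 \<le> n"
    and sidx: "\<And>i. i \<le> h \<Longrightarrow> sidx off i < length ss"
    and len: "\<And>s. s \<in> set ss \<Longrightarrow> length s = n"
begin

definition cells :: nat where "cells = Suc n ^ Suc h"

definition unit :: nat where "unit = (\<Sum>i<Suc h. Suc n ^ i)"

text \<open>A cell is coded by a number whose digits to base \<open>n + 1\<close> are the lengths of the prefixes
  considered.\<close>

definition feas :: "nat \<Rightarrow> nat set set" where
  "feas x = {A. A \<subseteq> {..<dig (Suc n) x 0} \<and>
     (\<forall>i\<in>{1..h}. subseq (nths (ss ! 0) A) (take (dig (Suc n) x i) (ss ! (off + i))))}"

definition full :: "nat set set" where
  "full = {A. A \<subseteq> {..<n} \<and> (\<forall>i\<in>{1..h}. subseq (nths (ss ! 0) A) (ss ! (off + i)))}"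

definition matching :: "nat \<Rightarrow> nat \<Rightarrow> bool" where
  "matching x i \<longleftrightarrow> sym_eq ss 0 (x mod Suc n - 1) (sidx off i) (dig (Suc n) x i - 1)"

lemma len_nth: "i \<le> h \<Longrightarrow> length (ss ! sidx off i) = n"
  using len sidx nth_mem by blast

lemma len_0: "length (ss ! 0) = n"
  using len_nth[of 0] by simp

lemma len_off: "1 \<le> i \<Longrightarrow> i \<le> h \<Longrightarrow> length (ss ! (off + i)) = n"
  using len_nth[of i] by simp

lemma dig_le: "dig (Suc n) x i \<le> n"
  using dig_less[of "Suc n" x i] by simp

lemma feas_top: "feas (cells - 1) = full"
proof -
  have "dig (Suc n) (cells - 1) i = n" if "i \<le> h" for i
    using dig_top[of i "Suc h" n] that by (simp add: cells_def del: power_Suc)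
  then show ?thesis unfolding feas_def full_def using len_off by auto
qed

lemma feas_0: "feas 0 = {{}}"
  by (auto simp: feas_def dig_def)

lemma empty_feas: "{} \<in> feas x"
  by (simp add: feas_def)

lemma feas_subset: "A \<in> feas x \<Longrightarrow> A \<subseteq> {..<n}"
  using dig_le[of x 0] by (fastforce simp: feas_def)

lemma feas_diff_power:
  assumes "x < cells" "i \<le> h" "0 < dig (Suc n) x i"
  shows "feas (x - Suc n ^ i) \<subseteq> feas x"
proof
  fix A assume A: "A \<in> feas (x - Suc n ^ i)"
  have le: "dig (Suc n) (x - Suc n ^ i) j \<le> dig (Suc n) x j" if "j \<le> h" for j
    using dig_diff_power[of x "Suc n" "Suc h" i j] assms that by (auto simp: cells_def)
  have t: "subseq (take a xs) (take b xs)" if "a \<le> b" for a b and xs :: "'a list"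
    using subseq_nths_mono[of "{..<a}" "{..<b}" xs] that by simp
  have "{..<dig (Suc n) (x - Suc n ^ i) 0} \<subseteq> {..<dig (Suc n) x 0}" using le[of 0] by auto
  moreover have "subseq (nths (ss ! 0) A) (take (dig (Suc n) x j) (ss ! (off + j)))" if "j \<in> {1..h}" for j
  proof -
    have "subseq (nths (ss ! 0) A) (take (dig (Suc n) (x - Suc n ^ i) j) (ss ! (off + j)))"
      using A that unfolding feas_def by blast
    moreover have "subseq (take (dig (Suc n) (x - Suc n ^ i) j) (ss ! (off + j)))
        (take (dig (Suc n) x j) (ss ! (off + j)))"
      using t[OF le[of j]] that by simp
    ultimately show ?thesis by (rule subseq_order.trans)
  qed
  ultimately show "A \<in> feas x" using A by (auto simp: feas_def)
qed

lemma feas_diff_unit: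
  assumes "x < cells" "\<And>i. i \<le> h \<Longrightarrow> 0 < dig (Suc n) x i \<and> matching x i"
    and A: "A \<in> feas (x - unit)"
  shows "x mod Suc n - 1 \<notin> A" "insert (x mod Suc n - 1) A \<in> feas x"
proof -
  define p where "p = x mod Suc n - 1"
  have p: "p < n" "dig (Suc n) x 0 = Suc p"
    using assms(2)[of 0] dig_le[of x 0] unfolding p_def dig_0 by linarith+
  have d: "dig (Suc n) (x - unit) j = dig (Suc n) x j - 1" if "j \<le> h" for j
    using dig_diff_repunit(1)[of x "Suc n" "Suc h" j] assms that
    by (auto simp: cells_def unit_def simp del: sum.lessThan_Suc power_Suc)
  have Ap: "A \<subseteq> {..<p}" using A d[of 0] p by (simp add: feas_def)
  then show "x mod Suc n - 1 \<notin> A" by (auto simp: p_def)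
  have "subseq (nths (ss ! 0) (insert p A)) (take (dig (Suc n) x i) (ss ! (off + i)))" if i: "i \<in> {1..h}" for i
  proof -
    obtain q where q: "dig (Suc n) x i = Suc q" using assms(2)[of i] i by (cases "dig (Suc n) x i") auto
    have qn: "q < n" using q dig_le[of x i] by simp
    have "ss ! 0 ! p = ss ! (off + i) ! q"
      using assms(2)[of i] i q unfolding matching_def sym_eq_def p_def by auto
    moreover have "subseq (nths (ss ! 0) A) (take q (ss ! (off + i)))"
      using A i d[of i] q by (auto simp: feas_def)
    moreover have "nths (ss ! 0) (insert p A) = nths (ss ! 0) A @ [ss ! 0 ! p]"
      using nths_insert_last[OF Ap, of "ss ! 0"] p len_0 by simp
    ultimately show ?thesis using q qn len_off i by (simp add: take_Suc_conv_app_nth list_emb_append_mono)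
  qed
  then have "insert p A \<in> feas x" using Ap p by (auto simp: feas_def)
  then show "insert (x mod Suc n - 1) A \<in> feas x" by (simp add: p_def)
qed

lemma feas_cases:
  assumes "x < cells" and A: "A \<in> feas x"
  obtains (empty) "A = {}"
  | (drop) i where "i \<le> h" "0 < dig (Suc n) x i" "A \<in> feas (x - Suc n ^ i)"
  | (match) A' where "\<And>i. i \<le> h \<Longrightarrow> 0 < dig (Suc n) x i \<and> matching x i"
      "A' \<in> feas (x - unit)" "A = insert (x mod Suc n - 1) A'" "x mod Suc n - 1 \<notin> A'"
proof (cases "A = {} \<or> (\<exists>i\<le>h. 0 < dig (Suc n) x i \<and> A \<in> feas (x - Suc n ^ i))")
  case True
  then show ?thesis using empty drop by blast
next
  case False
  then have nd: "A \<notin> feas (x - Suc n ^ i)" if "i \<le> h" "0 < dig (Suc n) x i" for i using that by blast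
  have ne: "A \<noteq> {}" using False by simp
  have An: "A \<subseteq> {..<n}" using feas_subset[OF A] .
  have pos: "0 < dig (Suc n) x i" if "i \<le> h" for i
  proof (rule ccontr)
    assume z: "\<not> 0 < dig (Suc n) x i"
    show False
    proof (cases "i = 0")
      case True
      then show False using z A ne by (auto simp: feas_def)
    next
      case False
      then have "subseq (nths (ss ! 0) A) (take (dig (Suc n) x i) (ss ! (off + i)))"
        using A that unfolding feas_def by auto
      then have "subseq (nths (ss ! 0) A) []" using z by simp
      then have "card A = 0" using length_nths_subset[of A "ss ! 0"] An len_0 list_emb_length by fastforce
      moreover have "finite A" using An finite_subset by blast
      ultimately show False using ne by simp
    qed
  qed
  have d1: "dig (Suc n) (x - Suc n ^ i) j = (if j = i then dig (Suc n) x i - 1 else dig (Suc n) x j)"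
    if "i \<le> h" "j \<le> h" for i j
    using dig_diff_power[of x "Suc n" "Suc h" i j] assms(1) that pos by (auto simp: cells_def)
  have d: "dig (Suc n) (x - unit) j = dig (Suc n) x j - 1" if "j \<le> h" for j
    using dig_diff_repunit(1)[of x "Suc n" "Suc h" j] assms that pos
    by (auto simp: cells_def unit_def simp del: sum.lessThan_Suc power_Suc)
  define p where "p = x mod Suc n - 1"
  have p: "p < n" "dig (Suc n) x 0 = Suc p"
    using pos[of 0] dig_le[of x 0] unfolding p_def dig_0 by linarith+
  have ASp: "A \<subseteq> {..<Suc p}" using A p by (simp add: feas_def)
  have "p \<in> A"
  proof (rule ccontr)
    assume "p \<notin> A"
    then have "A \<subseteq> {..<p}" using ASp by (force simp: less_Suc_eq)
    then have "A \<in> feas (x - Suc n ^ 0)"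
      using A p d1[of 0] unfolding feas_def by auto
    then show False using nd[OF le0 pos[OF le0]] by contradiction
  qed
  define A' where "A' = A - {p}"
  have A': "A = insert p A'" "p \<notin> A'" "A' \<subseteq> {..<p}"
    using \<open>p \<in> A\<close> ASp by (auto simp: A'_def less_Suc_eq)
  have nA: "nths (ss ! 0) A = nths (ss ! 0) A' @ [ss ! 0 ! p]"
    using nths_insert_last[OF A'(3), of "ss ! 0"] p len_0 A'(1) by simp
  have key: "ss ! 0 ! p = ss ! (off + i) ! (dig (Suc n) x i - 1) \<and>
      subseq (nths (ss ! 0) A') (take (dig (Suc n) x i - 1) (ss ! (off + i)))" if i: "i \<in> {1..h}" for i
  proof -
    obtain q where q: "dig (Suc n) x i = Suc q" using pos[of i] i by (cases "dig (Suc n) x i") auto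
    have qn: "q < n" using q dig_le[of x i] by simp
    have tk: "take (Suc q) (ss ! (off + i)) = take q (ss ! (off + i)) @ [ss ! (off + i) ! q]"
      using qn len_off i by (simp add: take_Suc_conv_app_nth)
    have s1: "subseq (nths (ss ! 0) A) (take (Suc q) (ss ! (off + i)))"
      using A i unfolding feas_def q[symmetric] by blast
    have s2: "\<not> subseq (nths (ss ! 0) A) (take q (ss ! (off + i)))"
    proof
      assume "subseq (nths (ss ! 0) A) (take q (ss ! (off + i)))"
      then have "A \<in> feas (x - Suc n ^ i)"
        using A i d1[of i] q unfolding feas_def by auto
      then show False using nd[of i] pos[of i] i by auto
    qed
    show ?thesis using subseq_append_single_last[OF s1[unfolded nA tk] s2[unfolded nA]] q by simp
  qed
  have m: "matching x i" if "i \<le> h" for i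
  proof (cases "i = 0")
    case True
    then show ?thesis using p sidx[of 0] len_0 unfolding matching_def sym_eq_def p_def[symmetric] by simp
  next
    case False
    have "dig (Suc n) x i - 1 < n" using dig_le[of x i] pos[OF that] by linarith
    then show ?thesis using p sidx[of 0] sidx[of i] len_0 len_off[of i] key[of i] that False
      unfolding matching_def sym_eq_def p_def[symmetric] by simp
  qed
  have "A' \<in> feas (x - unit)" using A' key d p unfolding feas_def by auto
  then show ?thesis using match[of A'] m pos A' by (auto simp: p_def)
qed

text \<open>\<open>V\<close> is the optimal weight, \<open>P\<close> the predecessor in an optimal path, and \<open>M\<close> tells
  whether the step from the predecessor adds a position.\<close>

definition cell_ok :: "(nat \<Rightarrow> nat) \<Rightarrow> (nat \<Rightarrow> nat) \<Rightarrow> (nat \<Rightarrow> nat) \<Rightarrow> (nat \<Rightarrow> nat) \<Rightarrow> nat \<Rightarrow> bool" where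
  "cell_ok w V P M x \<longleftrightarrow> (P x < x \<or> x = 0 \<and> P x = 0 \<and> V x = 0 \<and> M x = 0) \<and>
     (M x = 0 \<and> V x = V (P x) \<and> feas (P x) \<subseteq> feas x \<or>
      M x = 1 \<and> 0 < x mod Suc n \<and> V x = V (P x) + w (x mod Suc n - 1) \<and>
        (\<forall>A\<in>feas (P x). x mod Suc n - 1 \<notin> A \<and> insert (x mod Suc n - 1) A \<in> feas x))"

definition table_ok :: "(nat \<Rightarrow> nat) \<Rightarrow> (nat \<Rightarrow> nat) \<Rightarrow> (nat \<Rightarrow> nat) \<Rightarrow> (nat \<Rightarrow> nat) \<Rightarrow> nat \<Rightarrow> bool" where
  "table_ok w V P M X \<longleftrightarrow> (\<forall>x<X. cell_ok w V P M x \<and> (\<forall>A\<in>feas x. sum w A \<le> V x))"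

lemma cell_ok_cong:
  assumes "\<And>y. y \<le> x \<Longrightarrow> V y = V' y" "P x = P' x" "M x = M' x"
  shows "cell_ok w V P M x \<longleftrightarrow> cell_ok w V' P' M' x"
proof -
  have e: "V x = V' x" by (simp add: assms(1))
  show ?thesis
  proof (cases "P' x \<le> x")
    case True
    then have "V (P' x) = V' (P' x)" by (simp add: assms(1))
    then show ?thesis by (simp only: cell_ok_def e assms(2,3))
  next
    case False
    then show ?thesis by (auto simp add: cell_ok_def assms(2,3))
  qed
qed

lemma table_ok_cong:
  assumes "\<And>y. y < X \<Longrightarrow> V y = V' y \<and> P y = P' y \<and> M y = M' y"
  shows "table_ok w V P M X \<longleftrightarrow> table_ok w V' P' M' X"
proof -
  have "cell_ok w V P M x \<longleftrightarrow> cell_ok w V' P' M' x" if "x < X" for x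
    using assms that by (intro cell_ok_cong) auto
  then show ?thesis using assms unfolding table_ok_def by auto
qed

lemma table_attained:
  assumes "table_ok w V P M X" "x < X"
  shows "\<exists>A\<in>feas x. sum w A = V x"
  using assms(2)
proof (induction x rule: less_induct)
  case (less x)
  have c: "cell_ok w V P M x" using assms(1) less.prems by (simp add: table_ok_def)
  show ?case
  proof (cases "x = 0")
    case True
    then show ?thesis using c empty_feas[of x] by (intro bexI[of _ "{}"]) (auto simp: cell_ok_def)
  next
    case False
    then have lt: "P x < x" using c by (auto simp: cell_ok_def)
    then obtain A where A: "A \<in> feas (P x)" "sum w A = V (P x)" using less by fastforce
    have "finite A" using feas_subset[OF A(1)] finite_subset by blast
    then show ?thesis using c A unfolding cell_ok_def
      by (elim conjE disjE) (auto intro: bexI[of _ A] bexI[of _ "insert (x mod Suc n - 1) A"])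
  qed
qed

lemma table_le:
  assumes "table_ok w V P M X" "x < X"
  shows "V x \<le> sum w {..<n}"
proof -
  obtain A where "A \<in> feas x" "sum w A = V x" using table_attained[OF assms] by blast
  then show ?thesis using sum_mono2[OF _ feas_subset[of A x], of w] by simp
qed

lemma table_step:
  assumes "table_ok w V P M x" "x < cells" "cell_ok w V P M x"
    and drop: "\<And>i. i \<le> h \<Longrightarrow> 0 < dig (Suc n) x i \<Longrightarrow> V (x - Suc n ^ i) \<le> V x"
    and match: "(\<And>i. i \<le> h \<Longrightarrow> 0 < dig (Suc n) x i \<and> matching x i) \<Longrightarrow>
      V (x - unit) + w (x mod Suc n - 1) \<le> V x"
  shows "table_ok w V P M (Suc x)"
proof -
  have "sum w A \<le> V x" if A: "A \<in> feas x" for A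
    using assms(2) A
  proof (cases rule: feas_cases)
    case (drop i)
    have "x - Suc n ^ i < x" using power_le_if_dig_pos[OF drop(2)] by (simp add: less_le_trans[of 0 "Suc n ^ i"])
    then have "sum w A \<le> V (x - Suc n ^ i)" using assms(1) drop by (simp add: table_ok_def)
    then show ?thesis using assms(4)[OF drop(1,2)] by simp
  next
    case (match A')
    have "unit > 0" by (simp add: unit_def sum.lessThan_Suc_shift del: sum.lessThan_Suc)
    moreover have "unit \<le> x"
      using dig_diff_repunit(2)[of x "Suc n" "Suc h" 0] match assms(2)
      by (auto simp: cells_def unit_def simp del: sum.lessThan_Suc power_Suc)
    ultimately have "x - unit < x" by simp
    then have "sum w A' \<le> V (x - unit)" using assms(1) match by (simp add: table_ok_def)
    moreover have "finite A'" using feas_subset[OF match(2)] finite_subset by blast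
    ultimately show ?thesis using assms(5)[OF match(1)] match by simp
  qed simp
  then show ?thesis using assms(1,3) by (auto simp: table_ok_def less_Suc_eq)
qed

end

section \<open>The program\<close>

abbreviation var :: "string \<Rightarrow> aexp" where "var x \<equiv> Arr x (Const 0)"

abbreviation setv :: "string \<Rightarrow> aexp \<Rightarrow> com" where "setv x a \<equiv> Assign x (Const 0) a"

abbreviation incr :: "string \<Rightarrow> com" where "incr x \<equiv> setv x (Bin Plus (var x) (Const 1))"

text \<open>Variables: \<open>x\<close> is the current cell, \<open>i\<close> a coordinate or position, \<open>p\<close> the powers of
  \<open>B = n + 1\<close>, \<open>H = h + 1\<close>, \<open>N = B ^ H\<close> the number of cells, \<open>R\<close> the sum of the powers
  of \<open>B\<close> below \<open>N\<close>, \<open>o\<close> the offset of the current group, \<open>w\<close> the weights, \<open>V P M\<close> the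
  table, \<open>q\<close> tells whether all current symbols agree, \<open>A\<close> marks the set of the current round,
  \<open>C\<close> counts how often a position was omitted, \<open>b\<close> is the best length found so far.\<close>

definition digit_e :: aexp where
  "digit_e = Bin Modulo (Bin Divide (var ''x'') (Arr ''p'' (var ''i''))) (var ''B'')"

definition pos_e :: aexp where
  "pos_e = Bin Minus (Bin Modulo (var ''x'') (var ''B'')) (Const 1)"

definition sidx_e :: aexp where
  "sidx_e = Bin Plus (var ''i'') (Bin Times (var ''o'') (Bin Minus (Const 1) (Bin Minus (Const 1) (var ''i''))))"

definition coord_body :: com where
  "coord_body =
    Seq (If (Equal digit_e (Const 0)) (setv ''q'' (Const 0))
      (Seq (setv ''y'' (Bin Minus (var ''x'') (Arr ''p'' (var ''i''))))
      (Seq (If (Less (Arr ''V'' (var ''x'')) (Arr ''V'' (var ''y'')))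
             (Seq (Assign ''V'' (var ''x'') (Arr ''V'' (var ''y''))) (Assign ''P'' (var ''x'') (var ''y'')))
             Skip)
           (If (SymEq (Const 0) pos_e sidx_e (Bin Minus digit_e (Const 1))) Skip (setv ''q'' (Const 0))))))
    (incr ''i'')"

definition cell_init :: com where
  "cell_init =
    Seq (Assign ''V'' (var ''x'') (Const 0))
    (Seq (Assign ''P'' (var ''x'') (Const 0))
    (Seq (Assign ''M'' (var ''x'') (Const 0))
    (Seq (setv ''q'' (Const 1)) (setv ''i'' (Const 0)))))"

definition match_step :: com where
  "match_step =
    Seq (If (Equal (var ''q'') (Const 1))
      (Seq (setv ''y'' (Bin Minus (var ''x'') (var ''R'')))
      (Seq (setv ''z'' (Bin Plus (Arr ''V'' (var ''y'')) (Arr ''w'' pos_e)))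
      (If (Less (Arr ''V'' (var ''x'')) (var ''z''))
        (Seq (Assign ''V'' (var ''x'') (var ''z''))
        (Seq (Assign ''P'' (var ''x'') (var ''y''))
             (Assign ''M'' (var ''x'') (Const 1))))
        Skip)))
      Skip)
    (incr ''x'')"

definition coord_loop :: com where
  "coord_loop = While (Less (var ''i'') (var ''H'')) coord_body"

definition fill :: com where
  "fill = Seq (setv ''x'' (Const 0))
     (While (Less (var ''x'') (var ''N'')) (Seq cell_init (Seq coord_loop match_step)))"

context grid
begin

definition env :: "state \<Rightarrow> bool" where
  "env \<sigma> \<longleftrightarrow> \<sigma> ''n'' 0 = n \<and> \<sigma> ''B'' 0 = Suc n \<and> \<sigma> ''H'' 0 = Suc h \<and> \<sigma> ''N'' 0 = cells \<and>
     \<sigma> ''R'' 0 = unit \<and> (\<forall>i\<le>h. \<sigma> ''p'' i = Suc n ^ i)"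

definition ctxt :: "(nat \<Rightarrow> nat) \<Rightarrow> state \<Rightarrow> bool" where
  "ctxt w \<sigma> \<longleftrightarrow> env \<sigma> \<and> \<sigma> ''o'' 0 = off \<and> (\<forall>p<n. \<sigma> ''w'' p = w p)"

definition big :: "(nat \<Rightarrow> nat) \<Rightarrow> nat \<Rightarrow> bool" where
  "big w M \<longleftrightarrow> cells \<le> M \<and> h + off + 2 \<le> M \<and> 2 * sum w {..<n} \<le> M"

definition part_ok where
  "part_ok w x k V P M q \<longleftrightarrow> table_ok w V P M x \<and> cell_ok w V P M x \<and> M x = 0 \<and>
     (\<forall>i<k. 0 < dig (Suc n) x i \<longrightarrow> V (x - Suc n ^ i) \<le> V x) \<and>
     q = (if \<forall>i<k. 0 < dig (Suc n) x i \<and> matching x i then 1 else 0 :: nat)"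

lemma cells_gt: "n < cells" "0 < cells" "Suc n \<le> cells"
proof -
  have "Suc n ^ 1 \<le> cells" unfolding cells_def by (intro power_increasing) auto
  then show "n < cells" "0 < cells" "Suc n \<le> cells" by auto
qed

lemma unit_pos: "0 < unit"
  by (simp add: unit_def sum.lessThan_Suc_shift del: sum.lessThan_Suc)

lemma unit_le: "unit \<le> cells"
proof -
  have "(\<Sum>i<k. Suc n ^ i) \<le> Suc n ^ k" for k
  proof (induction k)
    case (Suc k)
    have "Suc n ^ Suc k = Suc n ^ k + n * Suc n ^ k" by simp
    moreover have "1 * Suc n ^ k \<le> n * Suc n ^ k" using n by (intro mult_le_mono1)
    ultimately show ?case using Suc unfolding sum.lessThan_Suc by linarith
  qed simp
  then show ?thesis by (simp only: unit_def cells_def)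
qed

lemma power_le_cells: "i \<le> Suc h \<Longrightarrow> Suc n ^ i \<le> cells"
  unfolding cells_def by (intro power_increasing) auto

lemma cell_diff_less: "0 < dig (Suc n) x i \<Longrightarrow> x - Suc n ^ i < x"
  using power_le_if_dig_pos[of "Suc n" x i] by (simp add: less_le_trans[of 0 "Suc n ^ i"])

lemma part_ok_le:
  assumes "part_ok w x k V P M q"
  shows "V x \<le> sum w {..<n}"
proof -
  have "V x = V (P x)" "P x < x \<or> x = 0 \<and> V x = 0" using assms by (auto simp: part_ok_def cell_ok_def)
  moreover have "V y \<le> sum w {..<n}" if "y < x" for y
    using table_le assms that unfolding part_ok_def by blast
  ultimately show ?thesis by force
qed

lemma part_ok_init:
  assumes "table_ok w V P M x"
  shows "part_ok w x 0 (V(x := 0)) (P(x := 0)) (M(x := 0)) 1"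
proof -
  have "table_ok w (V(x := 0)) (P(x := 0)) (M(x := 0)) x"
    using assms table_ok_cong[of x V "V(x := 0)" P "P(x := 0)" M "M(x := 0)" w] by simp
  moreover have "x \<noteq> 0 \<Longrightarrow> V 0 = 0"
    using assms unfolding table_ok_def cell_ok_def by fastforce
  ultimately show ?thesis using empty_feas by (auto simp: part_ok_def cell_ok_def feas_0)
qed

lemma part_ok_zero:
  assumes "part_ok w x k V P M q" "dig (Suc n) x k = 0"
  shows "part_ok w x (Suc k) V P M 0"
  using assms unfolding part_ok_def by (auto simp: less_Suc_eq)

lemma part_ok_pos:
  assumes "part_ok w x k V P M q" "0 < dig (Suc n) x k" "x < cells" "k \<le> h"
    and "y = x - Suc n ^ k"
  shows "\<not> V x < V y \<Longrightarrow> part_ok w x (Suc k) V P M (if matching x k then q else 0)"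
    and "V x < V y \<Longrightarrow> part_ok w x (Suc k) (V(x := V y)) (P(x := y)) M (if matching x k then q else 0)"
proof -
  have yx: "y < x" using cell_diff_less[OF assms(2)] assms(5) by simp
  have q: "(if matching x k then q else 0) =
      (if \<forall>i<Suc k. 0 < dig (Suc n) x i \<and> matching x i then 1 else 0 :: nat)"
    using assms(1,2) unfolding part_ok_def by (auto simp: less_Suc_eq)
  show "part_ok w x (Suc k) V P M (if matching x k then q else 0)" if "\<not> V x < V y"
    using assms that unfolding q unfolding part_ok_def by (auto simp: less_Suc_eq)
  assume lt: "V x < V y"
  let ?V = "V(x := V y)" and ?P = "P(x := y)"
  have "table_ok w ?V ?P M x"
    using assms(1) table_ok_cong[of x V ?V P ?P M M w] by (simp add: part_ok_def)
  moreover have "cell_ok w ?V ?P M x"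
    using yx feas_diff_power[OF assms(3,4,2)] assms(1,5) by (simp add: cell_ok_def part_ok_def)
  moreover have "?V (x - Suc n ^ i) \<le> ?V x" if "i < Suc k" "0 < dig (Suc n) x i" for i
  proof (cases "i = k")
    case True
    then show ?thesis using assms(5) by simp
  next
    case False
    then have "V (x - Suc n ^ i) \<le> V x" using that assms(1) by (simp add: part_ok_def)
    then show ?thesis using lt cell_diff_less[OF that(2)] by simp
  qed
  moreover have "M x = 0" using assms(1) by (simp add: part_ok_def)
  ultimately show "part_ok w x (Suc k) ?V ?P M (if matching x k then q else 0)"
    unfolding q unfolding part_ok_def by blast
qed

lemma part_ok_finish:
  assumes "part_ok w x (Suc h) V P M q" "x < cells"
  shows "q \<noteq> 1 \<Longrightarrow> table_ok w V P M (Suc x)"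
    and "q = 1 \<Longrightarrow> y = x - unit \<Longrightarrow> z = V y + w (x mod Suc n - 1) \<Longrightarrow> \<not> V x < z \<Longrightarrow>
      table_ok w V P M (Suc x)"
    and "q = 1 \<Longrightarrow> y = x - unit \<Longrightarrow> z = V y + w (x mod Suc n - 1) \<Longrightarrow> V x < z \<Longrightarrow>
      table_ok w (V(x := z)) (P(x := y)) (M(x := 1)) (Suc x)"
    and "q = 1 \<Longrightarrow> unit \<le> x \<and> 0 < x mod Suc n"
proof -
  have ok: "table_ok w V P M x" "cell_ok w V P M x" "M x = 0"
    and drop: "\<And>i. i \<le> h \<Longrightarrow> 0 < dig (Suc n) x i \<Longrightarrow> V (x - Suc n ^ i) \<le> V x"
    and q: "q = 1 \<longleftrightarrow> (\<forall>i\<le>h. 0 < dig (Suc n) x i \<and> matching x i)"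
    using assms unfolding part_ok_def by (auto simp: less_Suc_eq_le)
  show "table_ok w V P M (Suc x)" if "q \<noteq> 1"
    using table_step[OF ok(1) assms(2) ok(2) drop] that q by blast
  show "table_ok w V P M (Suc x)" if "q = 1" "y = x - unit" "z = V y + w (x mod Suc n - 1)" "\<not> V x < z"
    using table_step[OF ok(1) assms(2) ok(2) drop] that by simp
  show ux: "unit \<le> x \<and> 0 < x mod Suc n" if "q = 1"
    using dig_diff_repunit(2)[of x "Suc n" "Suc h" 0] that q assms(2) dig_0[of "Suc n" x]
    by (fastforce simp: cells_def unit_def less_Suc_eq_le simp del: sum.lessThan_Suc power_Suc)
  assume a: "q = 1" "y = x - unit" "z = V y + w (x mod Suc n - 1)" "V x < z"
  let ?V = "V(x := z)" and ?P = "P(x := y)" and ?M = "M(x := 1)"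
  have yx: "y < x" using a ux unit_pos by simp
  have "table_ok w ?V ?P ?M x"
    using ok(1) table_ok_cong[of x V ?V P ?P M ?M w] by simp
  moreover have "cell_ok w ?V ?P ?M x"
    using yx feas_diff_unit[OF assms(2)] a q ux[OF a(1)] by (simp add: cell_ok_def)
  moreover have "?V (x - Suc n ^ i) \<le> ?V x" if "i \<le> h" "0 < dig (Suc n) x i" for i
    using drop[OF that] cell_diff_less[OF that(2)] a(4) by simp
  moreover have "?V (x - unit) + w (x mod Suc n - 1) \<le> ?V x" using a yx by simp
  ultimately show "table_ok w ?V ?P ?M (Suc x)" using assms(2) by (intro table_step)
qed

definition coord_inv where
  "coord_inv w x k \<sigma> \<longleftrightarrow> ctxt w \<sigma> \<and> \<sigma> ''x'' 0 = x \<and> \<sigma> ''i'' 0 = k \<and>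
     part_ok w x k (\<sigma> ''V'') (\<sigma> ''P'') (\<sigma> ''M'') (\<sigma> ''q'' 0)"

lemma wp_coord_body:
  assumes inv: "coord_inv w x k \<sigma>" and "k \<le> h" "x < cells" and big: "big w Mx"
  shows "wp ss \<theta> Mx coord_body (tm coord_body) (coord_inv w x (Suc k)) \<sigma>"
proof (rule vc_sound)
  have c: "\<sigma> ''n'' 0 = n" "\<sigma> ''B'' 0 = Suc n" "\<sigma> ''H'' 0 = Suc h" "\<sigma> ''x'' 0 = x" "\<sigma> ''i'' 0 = k"
    "\<sigma> ''p'' k = Suc n ^ k" "\<sigma> ''o'' 0 = off"
    using inv assms(2) by (auto simp: coord_inv_def ctxt_def env_def)
  have p: "part_ok w x k (\<sigma> ''V'') (\<sigma> ''P'') (\<sigma> ''M'') (\<sigma> ''q'' 0)"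
    using inv by (simp add: coord_inv_def)
  have b: "Suc n \<le> Mx" "x \<le> Mx" "Suc n ^ k \<le> Mx" "k \<le> Mx" "Suc k \<le> Mx" "off \<le> Mx" "h + off + 2 \<le> Mx"
    using big assms(2,3) cells_gt power_le_cells[of k] by (auto simp: big_def)
  have sk: "sidx off k \<le> Mx" "off * (Suc 0 - (Suc 0 - k)) \<le> Mx" "Suc 0 - (Suc 0 - k) \<le> Mx" "Suc 0 - k \<le> Mx"
     "k + off * (Suc 0 - (Suc 0 - k)) = sidx off k"
    using b assms(2) by (cases k; simp add: sidx_def)+
  have dg: "x div Suc n ^ k mod Suc n = dig (Suc n) x k" "dig (Suc n) x k \<le> Mx" "x div Suc n ^ k \<le> Mx"
    "x mod Suc n \<le> Mx"
    "x mod Suc n - Suc 0 \<le> Mx" "dig (Suc n) x k - Suc 0 \<le> Mx" "x - Suc n ^ k \<le> Mx"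
    using b(1,2) dig_le[of x k] order_trans[OF div_le_dividend b(2)]
      order_trans[OF mod_less_eq_dividend b(2), of "Suc n"]
    by (auto simp: dig_def[symmetric])
  have v: "\<sigma> ''V'' x \<le> Mx" "\<And>y. y < x \<Longrightarrow> \<sigma> ''V'' y \<le> Mx"
  proof -
    have s: "sum w {..<n} \<le> Mx" using big by (simp add: big_def)
    then show "\<sigma> ''V'' x \<le> Mx" using part_ok_le[OF p] by simp
    have "table_ok w (\<sigma> ''V'') (\<sigma> ''P'') (\<sigma> ''M'') x" using p by (simp add: part_ok_def)
    then show "\<sigma> ''V'' y \<le> Mx" if "y < x" for y using table_le that s order_trans by blast
  qed
  show "vc ss \<theta> Mx coord_body (coord_inv w x (Suc k)) \<sigma>"
  proof (cases "dig (Suc n) x k = 0")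
    case True
    then show ?thesis
      using part_ok_zero[OF p True] inv b dg
      by (simp add: coord_body_def digit_e_def c coord_inv_def ctxt_def env_def)
  next
    case False
    then have pos: "0 < dig (Suc n) x k" by simp
    note st = part_ok_pos[OF p pos assms(3,2) refl]
    have yx: "x - Suc n ^ k < x" using cell_diff_less[OF pos] .
    have m: "sym_eq ss 0 (x mod Suc n - Suc 0) (sidx off k) (dig (Suc n) x k - Suc 0) \<longleftrightarrow> matching x k"
      by (simp add: matching_def)
    show ?thesis
    proof (cases "\<sigma> ''V'' x < \<sigma> ''V'' (x - Suc n ^ k)")
      case True
      show ?thesis using st(2)[OF True] True pos inv b dg sk v yx
        by (cases "matching x k")
          (simp_all add: coord_body_def digit_e_def pos_e_def sidx_e_def c m coord_inv_def ctxt_def env_def)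
    next
      case False
      show ?thesis using st(1)[OF False] False pos inv b dg sk v yx
        by (cases "matching x k")
          (simp_all add: coord_body_def digit_e_def pos_e_def sidx_e_def c m coord_inv_def ctxt_def env_def)
    qed
  qed
qed

lemma wp_cell:
  assumes inv: "ctxt w \<sigma>" "\<sigma> ''x'' 0 = x" "table_ok w (\<sigma> ''V'') (\<sigma> ''P'') (\<sigma> ''M'') x"
    and "x < cells" and big: "big w Mx"
  shows "wp ss \<theta> Mx (Seq cell_init (Seq coord_loop match_step)) (200 * (h + 2))
    (\<lambda>\<sigma>'. ctxt w \<sigma>' \<and> \<sigma>' ''x'' 0 = Suc x \<and> table_ok w (\<sigma>' ''V'') (\<sigma>' ''P'') (\<sigma>' ''M'') (Suc x)) \<sigma>"
proof -
  have xM: "x \<le> Mx" "Suc x \<le> Mx" "1 \<le> Mx" "Suc h \<le> Mx" "Suc n \<le> Mx" "unit \<le> Mx"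
    using assms(4) big cells_gt unit_le by (auto simp: big_def)
  have 1: "wp ss \<theta> Mx cell_init (tm cell_init) (coord_inv w x 0) \<sigma>"
  proof (rule vc_sound)
    show "vc ss \<theta> Mx cell_init (coord_inv w x 0) \<sigma>"
      using part_ok_init[OF inv(3)] inv(1,2) xM
      by (simp add: cell_init_def coord_inv_def ctxt_def env_def)
  qed
  have 2: "wp ss \<theta> Mx coord_loop (Suc h * (tm coord_body + bsz (Less (var ''i'') (var ''H'')) + 1)
      + bsz (Less (var ''i'') (var ''H'')) + 1) (coord_inv w x (Suc h)) \<sigma>'"
    if "coord_inv w x 0 \<sigma>'" for \<sigma>'
    unfolding coord_loop_def
  proof (rule wp_For)
    show "wp ss \<theta> Mx coord_body (tm coord_body) (coord_inv w x (Suc k)) \<tau>"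
      if "k < Suc h" "coord_inv w x k \<tau>" for k \<tau>
      using wp_coord_body[OF that(2) _ assms(4) big] that(1) by simp
    show "bbnd Mx (Less (var ''i'') (var ''H'')) \<tau> \<and>
        bval ss \<theta> (Less (var ''i'') (var ''H'')) \<tau> = (k < Suc h)"
      if "k \<le> Suc h" "coord_inv w x k \<tau>" for k \<tau>
      using that xM by (simp add: coord_inv_def ctxt_def env_def)
  qed (rule that)
  have 3: "wp ss \<theta> Mx match_step (tm match_step)
      (\<lambda>\<sigma>'. ctxt w \<sigma>' \<and> \<sigma>' ''x'' 0 = Suc x \<and> table_ok w (\<sigma>' ''V'') (\<sigma>' ''P'') (\<sigma>' ''M'') (Suc x)) \<sigma>'"
    if inv: "coord_inv w x (Suc h) \<sigma>'" for \<sigma>'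
  proof (rule vc_sound)
    have c: "\<sigma>' ''B'' 0 = Suc n" "\<sigma>' ''x'' 0 = x" "\<sigma>' ''R'' 0 = unit"
      using inv by (auto simp: coord_inv_def ctxt_def env_def)
    have p: "part_ok w x (Suc h) (\<sigma>' ''V'') (\<sigma>' ''P'') (\<sigma>' ''M'') (\<sigma>' ''q'' 0)"
      using inv by (simp add: coord_inv_def)
    have s: "2 * sum w {..<n} \<le> Mx" using big by (simp add: big_def)
    have vx: "\<sigma>' ''V'' x \<le> Mx" using part_ok_le[OF p] s by simp
    have q: "\<sigma>' ''q'' 0 \<le> 1" using p by (simp add: part_ok_def)
    have md: "x mod Suc n \<le> Mx" using xM(1) mod_less_eq_dividend order_trans by blast
    note f = part_ok_finish[OF p assms(4)]
    show "vc ss \<theta> Mx match_step (\<lambda>\<sigma>'. ctxt w \<sigma>' \<and> \<sigma>' ''x'' 0 = Suc x \<and>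
        table_ok w (\<sigma>' ''V'') (\<sigma>' ''P'') (\<sigma>' ''M'') (Suc x)) \<sigma>'"
    proof (cases "\<sigma>' ''q'' 0 = 1")
      case False
      then show ?thesis using f(1)[OF False] inv xM q
        by (simp add: match_step_def c coord_inv_def ctxt_def env_def)
    next
      case True
      have ux: "unit \<le> x" "0 < x mod Suc n" using f(4)[OF True] by auto
      have pn: "x mod Suc n - Suc 0 < n" using ux(2) mod_less_divisor[of "Suc n" x] by linarith
      have wv: "\<sigma>' ''w'' (x mod Suc n - Suc 0) = w (x mod Suc n - Suc 0)"
        using inv pn by (simp add: coord_inv_def ctxt_def)
      have "x - unit < x" using ux unit_pos by simp
      then have vy: "\<sigma>' ''V'' (x - unit) \<le> sum w {..<n}"
        using table_le[of w "\<sigma>' ''V''" "\<sigma>' ''P''" "\<sigma>' ''M''" x] p by (simp add: part_ok_def)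
      have wl: "w (x mod Suc n - Suc 0) \<le> sum w {..<n}"
        using pn by (intro member_le_sum) auto
      have z: "x - unit \<le> Mx" "x mod Suc n - Suc 0 \<le> Mx" "\<sigma>' ''V'' (x - unit) \<le> Mx" "w (x mod Suc n - Suc 0) \<le> Mx"
        "\<sigma>' ''V'' (x - unit) + w (x mod Suc n - Suc 0) \<le> Mx"
        using vy wl s xM(1) md by linarith+
      show ?thesis
      proof (cases "\<sigma>' ''V'' x < \<sigma>' ''V'' (x - unit) + w (x mod Suc n - 1)")
        case less: True
        show ?thesis using f(3)[OF True refl refl less] less True inv xM vx md z
          by (simp add: match_step_def pos_e_def c wv coord_inv_def ctxt_def env_def)
      next
        case False
        show ?thesis using f(2)[OF True refl refl False] False True inv xM vx md z
          by (simp add: match_step_def pos_e_def c wv coord_inv_def ctxt_def env_def)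
      qed
    qed
  qed
  show ?thesis
  proof (rule wp_conseq)
    show "wp ss \<theta> Mx (Seq cell_init (Seq coord_loop match_step)) (tm cell_init +
       ((Suc h * (tm coord_body + bsz (Less (var ''i'') (var ''H'')) + 1)
      + bsz (Less (var ''i'') (var ''H'')) + 1) + tm match_step))
      (\<lambda>\<sigma>'. ctxt w \<sigma>' \<and> \<sigma>' ''x'' 0 = Suc x \<and> table_ok w (\<sigma>' ''V'') (\<sigma>' ''P'') (\<sigma>' ''M'') (Suc x)) \<sigma>"
      by (intro wp_Seq'[OF 1] wp_Seq'[OF 2] 3)
  qed (simp_all add: cell_init_def coord_body_def match_step_def digit_e_def sidx_e_def pos_e_def)
qed

lemma wp_fill:
  assumes inv: "ctxt w \<sigma>" and big: "big w Mx"
  shows "wp ss \<theta> Mx fill (208 * (h + 2) * cells + 20)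
    (\<lambda>\<sigma>'. table_ok w (\<sigma>' ''V'') (\<sigma>' ''P'') (\<sigma>' ''M'') cells \<and>
      (\<forall>x. x \<notin> {''V'', ''P'', ''M'', ''x'', ''i'', ''q'', ''y'', ''z''} \<longrightarrow> \<sigma>' x = \<sigma> x)) \<sigma>"
proof -
  define I where "I k \<sigma> \<longleftrightarrow> ctxt w \<sigma> \<and> \<sigma> ''x'' 0 = k \<and> table_ok w (\<sigma> ''V'') (\<sigma> ''P'') (\<sigma> ''M'') k" for k \<sigma>
  let ?b = "Less (var ''x'') (var ''N'')" and ?c = "Seq cell_init (Seq coord_loop match_step)"
  have M: "cells \<le> Mx" "0 \<le> Mx" using big by (auto simp: big_def)
  have 1: "wp ss \<theta> Mx (setv ''x'' (Const 0)) (tm (setv ''x'' (Const 0))) (I 0) \<sigma>"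
    using inv by (intro vc_sound) (simp add: I_def ctxt_def env_def table_ok_def)
  have 2: "wp ss \<theta> Mx (While ?b ?c) (cells * (200 * (h + 2) + bsz ?b + 1) + bsz ?b + 1) (I cells) \<sigma>'"
    if "I 0 \<sigma>'" for \<sigma>'
  proof (rule wp_For)
    show "wp ss \<theta> Mx ?c (200 * (h + 2)) (I (Suc k)) \<tau>" if "k < cells" "I k \<tau>" for k \<tau>
      using wp_cell[of w \<tau> k Mx \<theta>] that big unfolding I_def by blast
    show "bbnd Mx ?b \<tau> \<and> bval ss \<theta> ?b \<tau> = (k < cells)" if "k \<le> cells" "I k \<tau>" for k \<tau>
      using that M by (simp add: I_def ctxt_def env_def)
  qed (rule that)
  have "wp ss \<theta> Mx fill (tm (setv ''x'' (Const 0)) +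
      (cells * (200 * (h + 2) + bsz ?b + 1) + bsz ?b + 1)) (I cells) \<sigma>"
    unfolding fill_def by (intro wp_Seq'[OF 1] 2)
  from wp_frame[OF this] show ?thesis
  proof (rule wp_conseq)
    have "cells * (200 * (h + 2) + 9) \<le> cells * (208 * (h + 2))" by (intro mult_le_mono2) simp
    then show "tm (setv ''x'' (Const 0)) + (cells * (200 * (h + 2) + bsz ?b + 1) + bsz ?b + 1)
        \<le> 208 * (h + 2) * cells + 20"
      by (simp add: algebra_simps)
    show "table_ok w (\<tau> ''V'') (\<tau> ''P'') (\<tau> ''M'') cells \<and>
        (\<forall>x. x \<notin> {''V'', ''P'', ''M'', ''x'', ''i'', ''q'', ''y'', ''z''} \<longrightarrow> \<tau> x = \<sigma> x)"
      if "I cells \<tau> \<and> (\<forall>x. x \<notin> writes fill \<longrightarrow> \<tau> x = \<sigma> x)" for \<tau>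
      using that by (simp add: I_def fill_def cell_init_def coord_loop_def coord_body_def match_step_def)
  qed
qed

end

definition trace_body :: com where
  "trace_body =
    Seq (If (Equal (Arr ''M'' (var ''x'')) (Const 1)) (Assign ''A'' pos_e (Const 1)) Skip)
        (setv ''x'' (Arr ''P'' (var ''x'')))"

definition trace :: com where
  "trace = Seq (setv ''x'' (Bin Minus (var ''N'') (Const 1))) (While (Less (Const 0) (var ''x'')) trace_body)"

definition prep_body :: com where
  "prep_body =
    Seq (Assign ''w'' (var ''i'')
          (Bin Plus (Bin Minus (Bin Minus (var ''K'') (Const 1)) (var ''j'')) (Arr ''C'' (var ''i''))))
    (Seq (Assign ''A'' (var ''i'') (Const 0)) (incr ''i''))"

definition upd_body :: com where
  "upd_body =
    Seq (Assign ''C'' (var ''i'')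
          (Bin Plus (Arr ''C'' (var ''i'')) (Bin Minus (Const 1) (Arr ''A'' (var ''i'')))))
    (Seq (Assign ''w'' (var ''i'') (Arr ''A'' (var ''i''))) (incr ''i''))"

definition for_n :: "com \<Rightarrow> com" where
  "for_n P = Seq (setv ''i'' (Const 0)) (While (Less (var ''i'') (var ''n'')) P)"

lemma wp_for_n:
  assumes "\<sigma> ''n'' 0 = n" "n \<le> Mx" "n \<ge> 1" "''n'' \<notin> writes P"
    and init: "I 0 (\<sigma>(''i'' := (\<sigma> ''i'')(0 := 0)))"
    and step: "\<And>k \<tau>. k < n \<Longrightarrow> I k \<tau> \<Longrightarrow> \<tau> ''n'' 0 = n \<Longrightarrow> \<tau> ''i'' 0 = k \<Longrightarrow>
      vc ss \<theta> Mx P (\<lambda>\<tau>'. I (Suc k) \<tau>' \<and> \<tau>' ''i'' 0 = Suc k) \<tau>"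
  shows "wp ss \<theta> Mx (for_n P) ((tm P + 30) * n)
    (\<lambda>\<tau>. I n \<tau> \<and> (\<forall>x. x \<notin> insert ''i'' (writes P) \<longrightarrow> \<tau> x = \<sigma> x)) \<sigma>"
proof -
  let ?b = "Less (var ''i'') (var ''n'')"
  define J where "J k \<tau> \<longleftrightarrow> I k \<tau> \<and> \<tau> ''n'' 0 = n \<and> \<tau> ''i'' 0 = k" for k \<tau>
  have 1: "wp ss \<theta> Mx (setv ''i'' (Const 0)) (tm (setv ''i'' (Const 0))) (J 0) \<sigma>"
    using assms(1) init by (intro vc_sound) (simp add: J_def)
  have 2: "wp ss \<theta> Mx (While ?b P) (n * (tm P + bsz ?b + 1) + bsz ?b + 1) (J n) \<tau>" if "J 0 \<tau>" for \<tau>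
  proof (rule wp_For)
    show "wp ss \<theta> Mx P (tm P) (J (Suc k)) \<tau>" if "k < n" "J k \<tau>" for k \<tau>
    proof -
      have "wp ss \<theta> Mx P (tm P) (\<lambda>\<tau>'. (I (Suc k) \<tau>' \<and> \<tau>' ''i'' 0 = Suc k) \<and>
          (\<forall>x. x \<notin> writes P \<longrightarrow> \<tau>' x = \<tau> x)) \<tau>"
        using that step[of k \<tau>] by (intro wp_frame vc_sound) (simp add: J_def)
      then show ?thesis
        by (rule wp_conseq) (use that assms(4) in \<open>auto simp: J_def\<close>)
    qed
    show "bbnd Mx ?b \<tau> \<and> bval ss \<theta> ?b \<tau> = (k < n)" if "k \<le> n" "J k \<tau>" for k \<tau>
      using that assms(2) by (simp add: J_def)
  qed (rule that)
  have "wp ss \<theta> Mx (for_n P) (tm (setv ''i'' (Const 0)) + (n * (tm P + bsz ?b + 1) + bsz ?b + 1)) (J n) \<sigma>"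
    unfolding for_n_def by (intro wp_Seq'[OF 1] 2)
  from wp_frame[OF this] show ?thesis
  proof (rule wp_conseq)
    show "tm (setv ''i'' (Const 0)) + (n * (tm P + bsz ?b + 1) + bsz ?b + 1) \<le> (tm P + 30) * n"
      using assms(3) by (simp add: algebra_simps)
  qed (auto simp: J_def for_n_def)
qed

lemma wp_prep:
  assumes "\<sigma> ''n'' 0 = n" "\<sigma> ''K'' 0 = K" "\<sigma> ''j'' 0 = j" "\<And>i. i < n \<Longrightarrow> \<sigma> ''C'' i \<le> K"
    and "j < K" "n \<le> Mx" "n \<ge> 1" "2 * K \<le> Mx"
  shows "wp ss \<theta> Mx (for_n prep_body) (100 * n)
    (\<lambda>\<tau>. (\<forall>i<n. \<tau> ''w'' i = (K - 1 - j) + \<sigma> ''C'' i \<and> \<tau> ''A'' i = 0) \<and>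
       (\<forall>x. x \<notin> {''i'', ''w'', ''A''} \<longrightarrow> \<tau> x = \<sigma> x)) \<sigma>"
proof -
  define I where "I k \<tau> \<longleftrightarrow> (\<forall>i<k. \<tau> ''w'' i = (K - 1 - j) + \<sigma> ''C'' i \<and> \<tau> ''A'' i = 0) \<and>
     \<tau> ''C'' = \<sigma> ''C'' \<and> \<tau> ''K'' 0 = K \<and> \<tau> ''j'' 0 = j" for k :: nat and \<tau> :: state
  have "vc ss \<theta> Mx prep_body (\<lambda>\<tau>'. I (Suc k) \<tau>' \<and> \<tau>' ''i'' 0 = Suc k) \<tau>"
    if "k < n" "I k \<tau>" "\<tau> ''n'' 0 = n" "\<tau> ''i'' 0 = k" for k \<tau>
  proof -
    have "K - Suc 0 \<le> Mx" "K - Suc j \<le> Mx" "K + \<sigma> ''C'' k - Suc j \<le> Mx" "K \<le> Mx" "\<sigma> ''C'' k \<le> Mx"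
      using assms(4)[OF that(1)] assms(8) by linarith+
    then show ?thesis using that assms(5-7)
      by (simp add: prep_body_def I_def less_Suc_eq)
  qed
  then have "wp ss \<theta> Mx (for_n prep_body) ((tm prep_body + 30) * n)
    (\<lambda>\<tau>. I n \<tau> \<and> (\<forall>x. x \<notin> insert ''i'' (writes prep_body) \<longrightarrow> \<tau> x = \<sigma> x)) \<sigma>"
    using assms by (intro wp_for_n) (auto simp: prep_body_def I_def)
  then show ?thesis
    by (rule wp_conseq) (auto simp: I_def prep_body_def)
qed

lemma wp_upd:
  assumes "\<sigma> ''n'' 0 = n" "\<And>i. i < n \<Longrightarrow> \<sigma> ''C'' i < Mx" "\<And>i. i < n \<Longrightarrow> \<sigma> ''A'' i \<le> 1"
    and "n \<le> Mx" "n \<ge> 1"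
  shows "wp ss \<theta> Mx (for_n upd_body) (100 * n)
    (\<lambda>\<tau>. (\<forall>i<n. \<tau> ''w'' i = \<sigma> ''A'' i \<and> \<tau> ''C'' i = \<sigma> ''C'' i + (1 - \<sigma> ''A'' i)) \<and>
       (\<forall>x. x \<notin> {''i'', ''w'', ''C''} \<longrightarrow> \<tau> x = \<sigma> x)) \<sigma>"
proof -
  define I where "I k \<tau> \<longleftrightarrow> (\<forall>i<k. \<tau> ''w'' i = \<sigma> ''A'' i \<and> \<tau> ''C'' i = \<sigma> ''C'' i + (1 - \<sigma> ''A'' i)) \<and>
     (\<forall>i\<ge>k. \<tau> ''C'' i = \<sigma> ''C'' i) \<and> \<tau> ''A'' = \<sigma> ''A''" for k :: nat and \<tau> :: state
  have "vc ss \<theta> Mx upd_body (\<lambda>\<tau>'. I (Suc k) \<tau>' \<and> \<tau>' ''i'' 0 = Suc k) \<tau>"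
    if "k < n" "I k \<tau>" "\<tau> ''n'' 0 = n" "\<tau> ''i'' 0 = k" for k \<tau>
  proof -
    have "\<sigma> ''A'' k \<le> Mx" "\<sigma> ''C'' k + (Suc 0 - \<sigma> ''A'' k) \<le> Mx" "Suc 0 - \<sigma> ''A'' k \<le> Mx"
      using assms(2,3)[OF that(1)] assms(4,5) by auto
    then show ?thesis using that assms(2)[OF that(1)] assms(4,5)
      by (simp add: upd_body_def I_def less_Suc_eq)
  qed
  then have "wp ss \<theta> Mx (for_n upd_body) ((tm upd_body + 30) * n)
    (\<lambda>\<tau>. I n \<tau> \<and> (\<forall>x. x \<notin> insert ''i'' (writes upd_body) \<longrightarrow> \<tau> x = \<sigma> x)) \<sigma>"
    using assms by (intro wp_for_n) (auto simp: upd_body_def I_def)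
  then show ?thesis
    by (rule wp_conseq) (auto simp: I_def upd_body_def)
qed

context grid
begin

definition trace_inv where
  "trace_inv w \<sigma> \<tau> \<longleftrightarrow> \<tau> ''V'' = \<sigma> ''V'' \<and> \<tau> ''P'' = \<sigma> ''P'' \<and> \<tau> ''M'' = \<sigma> ''M'' \<and> \<tau> ''B'' 0 = Suc n \<and>
     \<tau> ''x'' 0 < cells \<and> (\<forall>i<n. \<tau> ''A'' i \<le> 1) \<and>
     (\<forall>Y\<in>feas (\<tau> ''x'' 0). Y \<inter> {i. i < n \<and> \<tau> ''A'' i = 1} = {} \<and>
        Y \<union> {i. i < n \<and> \<tau> ''A'' i = 1} \<in> feas (cells - 1)) \<and>
     \<sigma> ''V'' (\<tau> ''x'' 0) + sum w {i. i < n \<and> \<tau> ''A'' i = 1} = \<sigma> ''V'' (cells - 1)"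

lemma wp_trace_body:
  assumes ok: "table_ok w (\<sigma> ''V'') (\<sigma> ''P'') (\<sigma> ''M'') cells"
    and inv: "trace_inv w \<sigma> \<tau>" and pos: "0 < \<tau> ''x'' 0" and Mx: "cells \<le> Mx"
  shows "wp ss \<theta> Mx trace_body (tm trace_body) (\<lambda>\<tau>'. trace_inv w \<sigma> \<tau>' \<and> \<tau>' ''x'' 0 < \<tau> ''x'' 0) \<tau>"
proof (rule vc_sound)
  define x where "x = \<tau> ''x'' 0"
  define S where "S = {i. i < n \<and> \<tau> ''A'' i = 1}"
  have i: "\<tau> ''V'' = \<sigma> ''V''" "\<tau> ''P'' = \<sigma> ''P''" "\<tau> ''M'' = \<sigma> ''M''" "\<tau> ''B'' 0 = Suc n"
    "x < cells" "\<And>i. i < n \<Longrightarrow> \<tau> ''A'' i \<le> 1"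
    "\<And>Y. Y \<in> feas x \<Longrightarrow> Y \<inter> S = {} \<and> Y \<union> S \<in> feas (cells - 1)"
    "\<sigma> ''V'' x + sum w S = \<sigma> ''V'' (cells - 1)" "\<tau> ''x'' 0 = x"
    using inv by (auto simp: trace_inv_def x_def S_def)
  have c: "cell_ok w (\<sigma> ''V'') (\<sigma> ''P'') (\<sigma> ''M'') x" using ok i(5) by (simp add: table_ok_def)
  have Px: "\<sigma> ''P'' x < x" using c pos by (auto simp: cell_ok_def x_def)
  have md: "x mod Suc n \<le> Mx" "x mod Suc n - Suc 0 \<le> Mx"
    using i(5) Mx mod_less_eq_dividend[of x "Suc n"] by linarith+
  have n1: "1 \<le> Mx" "Suc n \<le> Mx" using cells_gt Mx by linarith+
  consider (skip) "\<sigma> ''M'' x = 0" "\<sigma> ''V'' x = \<sigma> ''V'' (\<sigma> ''P'' x)" "feas (\<sigma> ''P'' x) \<subseteq> feas x"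
    | (take) "\<sigma> ''M'' x = 1" "0 < x mod Suc n"
      "\<sigma> ''V'' x = \<sigma> ''V'' (\<sigma> ''P'' x) + w (x mod Suc n - 1)"
      "\<forall>Y\<in>feas (\<sigma> ''P'' x). x mod Suc n - 1 \<notin> Y \<and> insert (x mod Suc n - 1) Y \<in> feas x"
    using c unfolding cell_ok_def by metis
  then show "vc ss \<theta> Mx trace_body (\<lambda>\<tau>'. trace_inv w \<sigma> \<tau>' \<and> \<tau>' ''x'' 0 < \<tau> ''x'' 0) \<tau>"
  proof cases
    case skip
    let ?\<tau> = "\<tau>(''x'' := (\<tau> ''x'')(0 := \<sigma> ''P'' x))"
    have S': "{i. i < n \<and> ?\<tau> ''A'' i = 1} = S" by (simp add: S_def)
    have "trace_inv w \<sigma> ?\<tau>" using i skip Px unfolding trace_inv_def S' by auto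
    then show ?thesis using skip i Px Mx n1 by (simp add: trace_body_def)
  next
    case take
    define p where "p = x mod Suc n - 1"
    have pn: "p < n" using take(2) mod_less_divisor[of "Suc n" x] unfolding p_def by linarith
    let ?\<tau> = "\<tau>(''A'' := (\<tau> ''A'')(p := 1), ''x'' := (\<tau> ''x'')(0 := \<sigma> ''P'' x))"
    have S': "{i. i < n \<and> ?\<tau> ''A'' i = 1} = insert p S" using pn by (auto simp: S_def)
    have ins: "p \<notin> Y" "insert p Y \<in> feas x" if "Y \<in> feas (\<sigma> ''P'' x)" for Y
      using bspec[OF take(4) that] by (auto simp: p_def)
    have pS: "p \<notin> S" using i(7)[OF ins(2)[OF empty_feas]] by auto
    have "Y \<inter> insert p S = {} \<and> Y \<union> insert p S \<in> feas (cells - 1)" if "Y \<in> feas (\<sigma> ''P'' x)" for Y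
      using i(7)[OF ins(2)[OF that]] ins(1)[OF that] by auto
    moreover have "finite S" by (simp add: S_def)
    then have "\<sigma> ''V'' (\<sigma> ''P'' x) + sum w (insert p S) = \<sigma> ''V'' (cells - 1)"
      using pS i(8) take(3) by (simp add: p_def)
    ultimately have "trace_inv w \<sigma> ?\<tau>" using i Px unfolding trace_inv_def S' by auto
    then show ?thesis using take i Px Mx md n1 by (simp add: trace_body_def pos_e_def p_def)
  qed
qed

lemma wp_trace:
  assumes ok: "table_ok w (\<sigma> ''V'') (\<sigma> ''P'') (\<sigma> ''M'') cells" and env: "env \<sigma>"
    and A0: "\<And>i. i < n \<Longrightarrow> \<sigma> ''A'' i = 0" and Mx: "cells \<le> Mx"
  shows "wp ss \<theta> Mx trace (100 * cells)
    (\<lambda>\<tau>. (\<forall>i<n. \<tau> ''A'' i \<le> 1) \<and> {i. i < n \<and> \<tau> ''A'' i = 1} \<in> full \<and>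
       (\<forall>Y\<in>full. sum w Y \<le> sum w {i. i < n \<and> \<tau> ''A'' i = 1}) \<and>
       (\<forall>x. x \<notin> {''x'', ''A''} \<longrightarrow> \<tau> x = \<sigma> x)) \<sigma>"
proof -
  let ?b = "Less (Const 0) (var ''x'')" and ?s = "setv ''x'' (Bin Minus (var ''N'') (Const 1))"
  have c2: "2 \<le> cells" "1 \<le> Mx" using cells_gt n Mx by linarith+
  have 1: "wp ss \<theta> Mx ?s (tm ?s) (trace_inv w \<sigma>) \<sigma>"
  proof (rule vc_sound)
    let ?\<tau> = "\<sigma>(''x'' := (\<sigma> ''x'')(0 := cells - 1))"
    have S: "{i. i < n \<and> ?\<tau> ''A'' i = 1} = {}" using A0 by auto
    have "\<sigma> ''B'' 0 = Suc n" using env by (simp add: env_def)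
    then have "trace_inv w \<sigma> ?\<tau>" using A0 c2 unfolding trace_inv_def S by auto
    then show "vc ss \<theta> Mx ?s (trace_inv w \<sigma>) \<sigma>"
      using env c2 Mx by (simp add: env_def)
  qed
  have 2: "wp ss \<theta> Mx (While ?b trace_body) (cells * (tm trace_body + bsz ?b + 1) + bsz ?b + 1)
      (\<lambda>\<tau>'. trace_inv w \<sigma> \<tau>' \<and> \<not> bval ss \<theta> ?b \<tau>') \<tau>" if "trace_inv w \<sigma> \<tau>" for \<tau>
  proof (rule wp_While[where \<mu> = "\<lambda>\<tau>. \<tau> ''x'' 0"])
    show "wp ss \<theta> Mx trace_body (tm trace_body) (\<lambda>\<tau>''. trace_inv w \<sigma> \<tau>'' \<and> \<tau>'' ''x'' 0 < \<tau>' ''x'' 0) \<tau>'"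
      if "trace_inv w \<sigma> \<tau>'" "bval ss \<theta> ?b \<tau>'" for \<tau>'
      using wp_trace_body[OF ok that(1) _ Mx] that(2) by simp
    show "bbnd Mx ?b \<tau>'" if "trace_inv w \<sigma> \<tau>'" for \<tau>'
      using that Mx by (simp add: trace_inv_def)
    show "trace_inv w \<sigma> \<tau>" by (rule that)
    show "\<tau> ''x'' 0 \<le> cells" using that by (simp add: trace_inv_def)
  qed
  have "wp ss \<theta> Mx trace (tm ?s + (cells * (tm trace_body + bsz ?b + 1) + bsz ?b + 1))
      (\<lambda>\<tau>'. trace_inv w \<sigma> \<tau>' \<and> \<not> bval ss \<theta> ?b \<tau>') \<sigma>"
    unfolding trace_def by (intro wp_Seq'[OF 1] 2)
  from wp_frame[OF this] show ?thesis
  proof (rule wp_conseq)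
    show "tm ?s + (cells * (tm trace_body + bsz ?b + 1) + bsz ?b + 1) \<le> 100 * cells"
      using c2 by (simp add: trace_body_def pos_e_def)
    fix \<tau>
    assume a: "(trace_inv w \<sigma> \<tau> \<and> \<not> bval ss \<theta> ?b \<tau>) \<and> (\<forall>x. x \<notin> writes trace \<longrightarrow> \<tau> x = \<sigma> x)"
    define S where "S = {i. i < n \<and> \<tau> ''A'' i = 1}"
    have x0: "\<tau> ''x'' 0 = 0" using a by simp
    have "\<sigma> ''V'' 0 = 0" using ok c2 unfolding table_ok_def cell_ok_def by fastforce
    then have S: "S \<in> feas (cells - 1)" "sum w S = \<sigma> ''V'' (cells - 1)"
      using a x0 feas_0 by (auto simp: trace_inv_def S_def)
    have "sum w Y \<le> \<sigma> ''V'' (cells - 1)" if "Y \<in> feas (cells - 1)" for Y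
      using ok that c2 by (simp add: table_ok_def)
    then show "(\<forall>i<n. \<tau> ''A'' i \<le> 1) \<and> {i. i < n \<and> \<tau> ''A'' i = 1} \<in> full \<and>
       (\<forall>Y\<in>full. sum w Y \<le> sum w {i. i < n \<and> \<tau> ''A'' i = 1}) \<and>
       (\<forall>x. x \<notin> {''x'', ''A''} \<longrightarrow> \<tau> x = \<sigma> x)"
      using a S unfolding feas_top S_def by (simp add: trace_inv_def trace_def trace_body_def)
  qed
qed

end

definition setup_body :: com where
  "setup_body =
    Seq (setv ''R'' (Bin Plus (var ''R'') (Arr ''p'' (var ''i''))))
    (Seq (Assign ''p'' (Bin Plus (var ''i'') (Const 1)) (Bin Times (Arr ''p'' (var ''i'')) (var ''B'')))
         (incr ''i''))"

definition setup_start :: com where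
  "setup_start =
    Seq (setv ''H'' (Bin Plus (Bin Divide (var ''m'') (Const 2)) (Const 1)))
    (Seq (setv ''B'' (Bin Plus (var ''n'') (Const 1)))
    (Seq (setv ''K'' (Bin Times (Const 3) (var ''n''))) (setv ''p'' (Const 1))))"

definition setup_prog :: com where
  "setup_prog = Seq setup_start
    (Seq (While (Less (var ''i'') (var ''H'')) setup_body) (setv ''N'' (Arr ''p'' (var ''H''))))"

definition record_best :: com where
  "record_best =
    Seq (If (Less (var ''b'') (Arr ''V'' (Bin Minus (var ''N'') (Const 1))))
          (setv ''b'' (Arr ''V'' (Bin Minus (var ''N'') (Const 1)))) Skip)
        (incr ''j'')"

definition set_off :: com where
  "set_off = setv ''o'' (Bin Minus (var ''m'') (var ''H''))"

definition round_prog :: com where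
  "round_prog =
    Seq (for_n prep_body) (Seq (setv ''o'' (Const 0)) (Seq fill (Seq trace
    (Seq (for_n upd_body) (Seq set_off (Seq fill record_best))))))"

definition guard_D :: bexp where
  "guard_D = Less (Bin Times (Bin Times (Const 32) (var ''n'')) (var ''D''))
     (Bin Plus (Bin Times (Bin Times (Const 16) (var ''n'')) (Bin Minus (var ''n'') (var ''b'')))
        (Bin Times (Bin Times (Const 3) (var ''D'')) (var ''D'')))"

definition decide :: com where
  "decide = If (LeTheta (var ''D'') (var ''n'')) (setv ''out'' (Const 1)) (setv ''out'' (Const 0))"

definition gap_prog :: com where
  "gap_prog = Seq setup_prog (Seq (While (Less (var ''j'') (var ''K'')) round_prog)
     (Seq (While guard_D (incr ''D'')) decide))"

lemma nths_Int_lessThan_length: "nths xs (A \<inter> {..<length xs}) = nths xs A"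
  unfolding nths_def by (auto intro!: arg_cong[where f = "map fst"] filter_cong dest: set_zip_rightD)

definition omitted :: "(nat \<Rightarrow> nat set) \<Rightarrow> nat \<Rightarrow> nat \<Rightarrow> nat" where
  "omitted A j i = card {l. l < j \<and> i \<notin> A l}"

lemma omitted_le: "omitted A j i \<le> j"
proof -
  have "card {l. l < j \<and> i \<notin> A l} \<le> card {..<j}" by (intro card_mono) auto
  then show ?thesis by (simp add: omitted_def)
qed

lemma omitted_upd: "l \<le> j \<Longrightarrow> omitted (A(j := S)) l i = omitted A l i"
  unfolding omitted_def by (intro arg_cong[where f = card]) auto

lemma omitted_Suc: "omitted A (Suc j) i = omitted A j i + (if i \<in> A j then 0 else 1)"
proof -
  have "{l. l < Suc j \<and> i \<notin> A l} = (if i \<in> A j then {l. l < j \<and> i \<notin> A l} else insert j {l. l < j \<and> i \<notin> A l})"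
    by (auto simp: less_Suc_eq)
  then show ?thesis by (simp add: omitted_def)
qed

locale strings =
  fixes ss :: "'a list list" and n m :: nat
  assumes n: "1 \<le> n" and m: "1 \<le> m" and length_ss: "length ss = m"
    and len: "\<And>s. s \<in> set ss \<Longrightarrow> length s = n"

sublocale strings \<subseteq> G1: grid ss n "m div 2" 0
proof
  fix i assume "i \<le> m div 2"
  then show "sidx 0 i < length ss" using m length_ss by (simp add: sidx_def)
qed (use n len in auto)

sublocale strings \<subseteq> G2: grid ss n "m div 2" "m - Suc (m div 2)"
proof
  fix i assume "i \<le> m div 2"
  then show "sidx (m - Suc (m div 2)) i < length ss" using m length_ss by (cases i) auto
qed (use n len in auto)

context strings
begin

definition Mx :: nat where "Mx = 64 * 2 ^ m * Suc n ^ (m div 2 + 3)"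

lemma Mx_bounds: "G1.cells \<le> Mx" "m + 2 \<le> Mx" "64 * (n * n) \<le> Mx" "n \<le> Mx" "64 * n \<le> Mx" "64 \<le> Mx"
proof -
  have 1: "G1.cells \<le> Suc n ^ (m div 2 + 3)" unfolding G1.cells_def by (intro power_increasing) auto
  have 2: "(1::nat) \<le> 64 * 2 ^ m" by simp
  show "G1.cells \<le> Mx" using mult_le_mono[OF 2 1] by (simp add: Mx_def)
  have p: "1 \<le> Suc n ^ (m div 2 + 3)" by simp
  have "m < 2 ^ m" by (rule less_exp)
  then have "m + 2 \<le> 64 * 2 ^ m" using m by linarith
  then show "m + 2 \<le> Mx" using mult_le_mono[OF _ p, of "m + 2" "64 * 2 ^ m"] by (simp add: Mx_def)
  have "Suc n ^ 2 \<le> Suc n ^ (m div 2 + 3)" by (intro power_increasing) auto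
  moreover have "n * n \<le> Suc n ^ 2" by (simp add: power2_eq_square)
  ultimately have q: "n * n \<le> Suc n ^ (m div 2 + 3)" by linarith
  have "(64::nat) * 1 \<le> 64 * 2 ^ m" by (intro mult_le_mono2) simp
  from mult_le_mono[OF this q] show s: "64 * (n * n) \<le> Mx" by (simp add: Mx_def)
  have "n * 1 \<le> n * n" using n by (intro mult_le_mono2)
  then show "n \<le> Mx" "64 * n \<le> Mx" "64 \<le> Mx" using s n by linarith+
qed

definition candidates :: "(nat \<Rightarrow> nat set) \<Rightarrow> nat \<Rightarrow> nat \<Rightarrow> bool" where
  "candidates A j b \<longleftrightarrow> (\<forall>l<j. A l \<in> G1.full \<and>
       (\<forall>X\<in>G1.full. (\<Sum>i\<in>X. (3 * n - 1 - l) + omitted A l i) \<le> (\<Sum>i\<in>A l. (3 * n - 1 - l) + omitted A l i)) \<and>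
       (\<forall>X\<in>G2.full. card (X \<inter> A l) \<le> b)) \<and>
     (\<exists>X\<in>G1.full \<inter> G2.full. card X = b)"

definition round_inv :: "nat \<Rightarrow> state \<Rightarrow> bool" where
  "round_inv j \<sigma> \<longleftrightarrow> G1.env \<sigma> \<and> \<sigma> ''m'' 0 = m \<and> \<sigma> ''K'' 0 = 3 * n \<and> \<sigma> ''j'' 0 = j \<and> \<sigma> ''D'' 0 = 0 \<and>
     (\<exists>A. candidates A j (\<sigma> ''b'' 0) \<and> (\<forall>i<n. \<sigma> ''C'' i = omitted A j i))"

lemma full_subset: "X \<in> G1.full \<Longrightarrow> X \<subseteq> {..<n}" "X \<in> G2.full \<Longrightarrow> X \<subseteq> {..<n}"
  by (auto simp: G1.full_def G2.full_def)

lemma full_Int: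
  assumes X: "X \<in> G1.full" and Y: "Y \<in> G2.full"
  shows "Y \<inter> X \<in> G1.full \<inter> G2.full"
proof -
  have "subseq (nths (ss ! 0) (Y \<inter> X)) (nths (ss ! 0) X)" "subseq (nths (ss ! 0) (Y \<inter> X)) (nths (ss ! 0) Y)"
    by (auto intro: subseq_nths_mono)
  then have "subseq (nths (ss ! 0) (Y \<inter> X)) s" if "subseq (nths (ss ! 0) X) s \<or> subseq (nths (ss ! 0) Y) s" for s
    using that subseq_order.trans by blast
  then show ?thesis using X Y full_subset(1)[OF X] by (auto simp: G1.full_def G2.full_def)
qed

lemma candidates_Suc:
  assumes "candidates A j b" and S: "S \<in> G1.full"
    and greedy: "\<And>X. X \<in> G1.full \<Longrightarrow>
      (\<Sum>i\<in>X. (3 * n - 1 - j) + omitted A j i) \<le> (\<Sum>i\<in>S. (3 * n - 1 - j) + omitted A j i)"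
    and b: "\<And>X. X \<in> G2.full \<Longrightarrow> card (X \<inter> S) \<le> v" and v: "\<exists>X\<in>G2.full. card (X \<inter> S) = v"
  shows "candidates (A(j := S)) (Suc j) (max b v)"
proof -
  have "\<exists>X\<in>G1.full \<inter> G2.full. card X = max b v"
    using v full_Int[OF S] assms(1) unfolding candidates_def max_def by metis
  moreover have "(A(j := S)) l \<in> G1.full \<and>
       (\<forall>X\<in>G1.full. (\<Sum>i\<in>X. (3 * n - 1 - l) + omitted (A(j := S)) l i)
          \<le> (\<Sum>i\<in>(A(j := S)) l. (3 * n - 1 - l) + omitted (A(j := S)) l i)) \<and>
       (\<forall>X\<in>G2.full. card (X \<inter> (A(j := S)) l) \<le> max b v)" if "l < Suc j" for l
  proof (cases "l = j")
    case True
    then show ?thesis using S greedy b omitted_upd[of j j A S] by (simp add: le_max_iff_disj)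
  next
    case False
    then have "l < j" using that by simp
    then show ?thesis using assms(1) omitted_upd[of l j A S] unfolding candidates_def
      by (simp add: le_max_iff_disj)
  qed
  ultimately show ?thesis unfolding candidates_def by blast
qed

lemma wp_round:
  assumes inv: "round_inv j \<sigma>" and j: "j < 3 * n"
  shows "wp ss \<theta> Mx round_prog (1000 * (m div 2 + 2) * G1.cells) (round_inv (Suc j)) \<sigma>"
proof -
  note M = Mx_bounds
  obtain A where A: "candidates A j (\<sigma> ''b'' 0)" "\<And>i. i < n \<Longrightarrow> \<sigma> ''C'' i = omitted A j i"
    using inv by (auto simp: round_inv_def)
  have env: "G1.env \<sigma>" "\<sigma> ''m'' 0 = m" "\<sigma> ''K'' 0 = 3 * n" "\<sigma> ''j'' 0 = j" "\<sigma> ''n'' 0 = n" "\<sigma> ''D'' 0 = 0"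
    using inv by (auto simp: round_inv_def G1.env_def)
  have env_cong: "G1.env \<tau>" if "\<And>x. x \<in> {''n'', ''B'', ''H'', ''N'', ''R'', ''p''} \<Longrightarrow> \<tau> x = \<sigma> x" for \<tau>
    using env(1) that by (simp add: G1.env_def)
  define w where "w i = (3 * n - 1 - j) + omitted A j i" for i
  have "wp ss \<theta> Mx (for_n prep_body) (100 * n)
    (\<lambda>\<tau>. (\<forall>i<n. \<tau> ''w'' i = (3 * n - 1 - j) + \<sigma> ''C'' i \<and> \<tau> ''A'' i = 0) \<and>
       (\<forall>x. x \<notin> {''i'', ''w'', ''A''} \<longrightarrow> \<tau> x = \<sigma> x)) \<sigma>"
  proof (rule wp_prep)
    show "\<sigma> ''C'' i \<le> 3 * n" if "i < n" for i
      using A(2)[OF that] omitted_le[of A j i] j by linarith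
    show "2 * (3 * n) \<le> Mx" using M(5) by linarith
  qed (use env j M n in auto)
  then obtain t1 \<sigma>1 where 1: "exec ss \<theta> (for_n prep_body) \<sigma> t1 \<sigma>1" "t1 \<le> 100 * n * bits Mx"
    "\<And>i. i < n \<Longrightarrow> \<sigma>1 ''w'' i = w i" "\<And>i. i < n \<Longrightarrow> \<sigma>1 ''A'' i = 0"
    and f1: "\<And>x. x \<notin> {''i'', ''w'', ''A''} \<Longrightarrow> \<sigma>1 x = \<sigma> x"
    unfolding wp_def using A(2) by (auto simp: w_def)
  have "wp ss \<theta> Mx (setv ''o'' (Const 0)) (tm (setv ''o'' (Const 0)))
      (\<lambda>\<tau>. \<tau> = \<sigma>1(''o'' := (\<sigma>1 ''o'')(0 := 0))) \<sigma>1"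
    by (rule vc_sound) simp
  then obtain t2 \<sigma>2 where 2: "exec ss \<theta> (setv ''o'' (Const 0)) \<sigma>1 t2 \<sigma>2" "t2 \<le> 4 * bits Mx"
    "\<sigma>2 = \<sigma>1(''o'' := (\<sigma>1 ''o'')(0 := 0))"
    unfolding wp_def by auto
  have sw: "2 * sum w {..<n} \<le> Mx"
  proof -
    have "sum w {..<n} \<le> (\<Sum>i<n. 6 * n)"
    proof (rule sum_mono)
      show "w i \<le> 6 * n" for i using j omitted_le[of A j i] by (simp add: w_def)
    qed
    then show ?thesis using M(3) by simp
  qed
  have e2: "G1.env \<sigma>2" by (intro env_cong) (auto simp: 2(3) f1)
  have "wp ss \<theta> Mx fill (208 * (m div 2 + 2) * G1.cells + 20)
    (\<lambda>\<sigma>'. G1.table_ok w (\<sigma>' ''V'') (\<sigma>' ''P'') (\<sigma>' ''M'') G1.cells \<and>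
      (\<forall>x. x \<notin> {''V'', ''P'', ''M'', ''x'', ''i'', ''q'', ''y'', ''z''} \<longrightarrow> \<sigma>' x = \<sigma>2 x)) \<sigma>2"
  proof (rule G1.wp_fill)
    show "G1.ctxt w \<sigma>2" using e2 1(3) by (simp add: G1.ctxt_def 2(3))
    show "G1.big w Mx" using M sw by (simp add: G1.big_def)
  qed
  then obtain t3 \<sigma>3 where 3: "exec ss \<theta> fill \<sigma>2 t3 \<sigma>3" "t3 \<le> (208 * (m div 2 + 2) * G1.cells + 20) * bits Mx"
    "G1.table_ok w (\<sigma>3 ''V'') (\<sigma>3 ''P'') (\<sigma>3 ''M'') G1.cells"
    and f3: "\<And>x. x \<notin> {''V'', ''P'', ''M'', ''x'', ''i'', ''q'', ''y'', ''z''} \<Longrightarrow> \<sigma>3 x = \<sigma>2 x"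
    unfolding wp_def by auto
  have e3: "G1.env \<sigma>3" by (intro env_cong) (auto simp: 2(3) f1 f3)
  have "wp ss \<theta> Mx trace (100 * G1.cells)
    (\<lambda>\<tau>. (\<forall>i<n. \<tau> ''A'' i \<le> 1) \<and> {i. i < n \<and> \<tau> ''A'' i = 1} \<in> G1.full \<and>
       (\<forall>Y\<in>G1.full. sum w Y \<le> sum w {i. i < n \<and> \<tau> ''A'' i = 1}) \<and>
       (\<forall>x. x \<notin> {''x'', ''A''} \<longrightarrow> \<tau> x = \<sigma>3 x)) \<sigma>3"
    using 1(4) by (intro G1.wp_trace[OF 3(3) e3] M) (simp add: f3 2(3))
  then obtain t4 \<sigma>4 where 4: "exec ss \<theta> trace \<sigma>3 t4 \<sigma>4" "t4 \<le> 100 * G1.cells * bits Mx"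
    "\<And>i. i < n \<Longrightarrow> \<sigma>4 ''A'' i \<le> 1" "{i. i < n \<and> \<sigma>4 ''A'' i = 1} \<in> G1.full"
    "\<And>Y. Y \<in> G1.full \<Longrightarrow> sum w Y \<le> sum w {i. i < n \<and> \<sigma>4 ''A'' i = 1}"
    and f4: "\<And>x. x \<notin> {''x'', ''A''} \<Longrightarrow> \<sigma>4 x = \<sigma>3 x"
    unfolding wp_def by auto
  define S where "S = {i. i < n \<and> \<sigma>4 ''A'' i = 1}"
  have AS: "\<sigma>4 ''A'' i = (if i \<in> S then 1 else 0)" if "i < n" for i
    using 4(3)[OF that] that by (auto simp: S_def)
  have C4: "\<sigma>4 ''C'' i = omitted A j i" if "i < n" for i
    using A(2)[OF that] by (simp add: f4 f3 f1 2(3))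
  have "wp ss \<theta> Mx (for_n upd_body) (100 * n)
    (\<lambda>\<tau>. (\<forall>i<n. \<tau> ''w'' i = \<sigma>4 ''A'' i \<and> \<tau> ''C'' i = \<sigma>4 ''C'' i + (1 - \<sigma>4 ''A'' i)) \<and>
       (\<forall>x. x \<notin> {''i'', ''w'', ''C''} \<longrightarrow> \<tau> x = \<sigma>4 x)) \<sigma>4"
  proof (rule wp_upd)
    show "\<sigma>4 ''n'' 0 = n" using env(5) by (simp add: f4 f3 f1 2(3))
    show "\<sigma>4 ''C'' i < Mx" if "i < n" for i
      using C4[OF that] omitted_le[of A j i] j M(5) by linarith
  qed (use 4(3) M n in auto)
  then obtain t5 \<sigma>5 where 5: "exec ss \<theta> (for_n upd_body) \<sigma>4 t5 \<sigma>5" "t5 \<le> 100 * n * bits Mx"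
    "\<And>i. i < n \<Longrightarrow> \<sigma>5 ''w'' i = (if i \<in> S then 1 else 0)"
    "\<And>i. i < n \<Longrightarrow> \<sigma>5 ''C'' i = omitted (A(j := S)) (Suc j) i"
    and f5: "\<And>x. x \<notin> {''i'', ''w'', ''C''} \<Longrightarrow> \<sigma>5 x = \<sigma>4 x"
    unfolding wp_def using AS C4 by (auto simp: omitted_Suc omitted_upd)
  have H5: "\<sigma>5 ''H'' 0 = Suc (m div 2)" "\<sigma>5 ''m'' 0 = m"
    using env(1,2) by (auto simp: f5 f4 f3 f1 2(3) G1.env_def)
  have "wp ss \<theta> Mx set_off (tm set_off)
      (\<lambda>\<tau>. \<tau> = \<sigma>5(''o'' := (\<sigma>5 ''o'')(0 := m - Suc (m div 2)))) \<sigma>5"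
    using M m by (intro vc_sound) (auto simp: set_off_def H5)
  then obtain t6 \<sigma>6 where 6: "exec ss \<theta> set_off \<sigma>5 t6 \<sigma>6" "t6 \<le> 20 * bits Mx"
    "\<sigma>6 = \<sigma>5(''o'' := (\<sigma>5 ''o'')(0 := m - Suc (m div 2)))"
    unfolding wp_def by (fastforce simp: set_off_def)
  define w' where "w' i = (if i \<in> S then 1 else 0 :: nat)" for i
  have sw': "sum w' Y = card (Y \<inter> S)" if "Y \<subseteq> {..<n}" for Y
    using that finite_subset[OF that] unfolding w'_def by (simp add: sum.If_cases)
  have e6: "G1.env \<sigma>6" by (intro env_cong) (auto simp: 2(3) 6(3) f5 f4 f3 f1)
  have "wp ss \<theta> Mx fill (208 * (m div 2 + 2) * G1.cells + 20)
    (\<lambda>\<sigma>'. G2.table_ok w' (\<sigma>' ''V'') (\<sigma>' ''P'') (\<sigma>' ''M'') G1.cells \<and>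
      (\<forall>x. x \<notin> {''V'', ''P'', ''M'', ''x'', ''i'', ''q'', ''y'', ''z''} \<longrightarrow> \<sigma>' x = \<sigma>6 x)) \<sigma>6"
  proof (rule G2.wp_fill)
    show "G2.ctxt w' \<sigma>6" using e6 5(3) by (simp add: G2.ctxt_def 6(3) w'_def)
    have "card ({..<n} \<inter> S) \<le> card {..<n}" by (intro card_mono) auto
    then have "sum w' {..<n} \<le> n" by (simp add: sw')
    then show "G2.big w' Mx" using M m by (simp add: G2.big_def)
  qed
  then obtain t7 \<sigma>7 where 7: "exec ss \<theta> fill \<sigma>6 t7 \<sigma>7" "t7 \<le> (208 * (m div 2 + 2) * G1.cells + 20) * bits Mx"
    "G2.table_ok w' (\<sigma>7 ''V'') (\<sigma>7 ''P'') (\<sigma>7 ''M'') G1.cells"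
    and f7: "\<And>x. x \<notin> {''V'', ''P'', ''M'', ''x'', ''i'', ''q'', ''y'', ''z''} \<Longrightarrow> \<sigma>7 x = \<sigma>6 x"
    unfolding wp_def by auto
  define v where "v = \<sigma>7 ''V'' (G1.cells - 1)"
  have cp: "G1.cells - 1 < G1.cells" using G1.cells_gt by simp
  have v1: "\<exists>X\<in>G2.full. card (X \<inter> S) = v"
    using G2.table_attained[OF 7(3) cp] full_subset(2) unfolding G2.feas_top v_def by (metis sw')
  have v2: "card (X \<inter> S) \<le> v" if "X \<in> G2.full" for X
    using 7(3) cp that sw'[OF full_subset(2)[OF that]] unfolding G2.table_ok_def v_def
    by (metis G2.feas_top)
  have cand: "candidates (A(j := S)) (Suc j) (max (\<sigma> ''b'' 0) v)"
    using candidates_Suc[OF A(1) _ _ v2 v1] 4(4,5) unfolding S_def[symmetric] w_def by blast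
  have vn: "v \<le> n"
  proof -
    obtain X where "X \<in> G2.full" "card (X \<inter> S) = v" using v1 by blast
    then have "v \<le> card {..<n}" using full_subset(2)[of X] by (metis card_mono finite_lessThan inf.coboundedI1)
    then show ?thesis by simp
  qed
  have bn: "\<sigma> ''b'' 0 \<le> n"
  proof -
    obtain X where X: "X \<in> G2.full" "card X = \<sigma> ''b'' 0" using A(1) by (auto simp: candidates_def)
    have "card X \<le> card {..<n}" using full_subset(2)[OF X(1)] by (intro card_mono) auto
    then show ?thesis using X by simp
  qed
  have s7: "\<sigma>7 ''b'' 0 = \<sigma> ''b'' 0" "\<sigma>7 ''j'' 0 = j" "\<sigma>7 ''N'' 0 = G1.cells" "\<sigma>7 ''m'' 0 = m"
    "\<sigma>7 ''K'' 0 = 3 * n" "\<sigma>7 ''D'' 0 = 0"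
    using env by (auto simp: f7 6(3) f5 f4 f3 f1 2(3) G1.env_def)
  have C7: "\<sigma>7 ''C'' i = omitted (A(j := S)) (Suc j) i" if "i < n" for i
    using 5(4)[OF that] by (simp add: f7 6(3))
  have e7: "G1.env \<sigma>7" by (intro env_cong) (auto simp: 2(3) 6(3) f5 f4 f3 f1 f7)
  have "wp ss \<theta> Mx record_best (tm record_best) (round_inv (Suc j)) \<sigma>7"
  proof (rule vc_sound)
    have bd: "\<sigma> ''b'' 0 \<le> Mx" "v \<le> Mx" "G1.cells \<le> Mx" "G1.cells - Suc 0 \<le> Mx" "Suc j \<le> Mx" "Suc 0 \<le> Mx"
      using bn vn M j by linarith+
    have vv: "\<sigma>7 ''V'' (G1.cells - Suc 0) = v" by (simp add: v_def)
    have ex: "\<exists>A. candidates A (Suc j) (max (\<sigma> ''b'' 0) v) \<and> (\<forall>i<n. \<sigma>7 ''C'' i = omitted A (Suc j) i)"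
      using cand C7 by blast
    show "vc ss \<theta> Mx record_best (round_inv (Suc j)) \<sigma>7"
    proof (cases "\<sigma> ''b'' 0 < v")
      case True
      then have "max (\<sigma> ''b'' 0) v = v" by simp
      then show ?thesis using True ex e7 bd
        by (simp add: record_best_def s7 vv round_inv_def G1.env_def)
    next
      case False
      then have "max (\<sigma> ''b'' 0) v = \<sigma> ''b'' 0" by simp
      then show ?thesis using False ex e7 bd
        by (simp add: record_best_def s7 vv round_inv_def G1.env_def)
    qed
  qed
  then obtain t8 \<sigma>8 where 8: "exec ss \<theta> record_best \<sigma>7 t8 \<sigma>8" "t8 \<le> 100 * bits Mx" "round_inv (Suc j) \<sigma>8"
    unfolding wp_def by (fastforce simp: record_best_def)
  have ex: "exec ss \<theta> round_prog \<sigma> (t1 + (t2 + (t3 + (t4 + (t5 + (t6 + (t7 + t8))))))) \<sigma>8"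
    unfolding round_prog_def by (intro exec.Seq) (fact 1(1) 2(1) 3(1) 4(1) 5(1) 6(1) 7(1) 8(1))+
  have "t1 + (t2 + (t3 + (t4 + (t5 + (t6 + (t7 + t8)))))) \<le>
     (200 * n + 164 + 416 * (m div 2 + 2) * G1.cells + 100 * G1.cells) * bits Mx"
    using 1(2) 2(2) 3(2) 4(2) 5(2) 6(2) 7(2) 8(2) by (simp add: algebra_simps)
  also have "\<dots> \<le> (1000 * (m div 2 + 2) * G1.cells) * bits Mx"
  proof (rule mult_le_mono1)
    have "G1.cells * 2 \<le> G1.cells * (m div 2 + 2)" by simp
    then show "200 * n + 164 + 416 * (m div 2 + 2) * G1.cells + 100 * G1.cells \<le> 1000 * (m div 2 + 2) * G1.cells"
      using G1.cells_gt n by (simp add: algebra_simps)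
  qed
  finally show ?thesis unfolding wp_def using ex 8(3) by blast
qed

end

context strings
begin

lemma wp_setup: "wp ss \<theta> Mx setup_prog (200 * (m div 2 + 2)) (round_inv 0) (init_state m n)"
proof -
  note M = Mx_bounds
  let ?b = "Less (var ''i'') (var ''H'')"
  define I where "I k \<tau> \<longleftrightarrow> \<tau> ''n'' 0 = n \<and> \<tau> ''m'' 0 = m \<and> \<tau> ''H'' 0 = Suc (m div 2) \<and> \<tau> ''B'' 0 = Suc n \<and>
     \<tau> ''K'' 0 = 3 * n \<and> \<tau> ''j'' 0 = 0 \<and> \<tau> ''D'' 0 = 0 \<and> \<tau> ''b'' 0 = 0 \<and> (\<forall>i. \<tau> ''C'' i = 0) \<and> \<tau> ''i'' 0 = k \<and>
     (\<forall>i\<le>k. \<tau> ''p'' i = Suc n ^ i) \<and> \<tau> ''R'' 0 = (\<Sum>i<k. Suc n ^ i)" for k and \<tau> :: state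
  have bd: "m \<le> Mx" "m div 2 \<le> Mx" "Suc (m div 2) \<le> Mx" "Suc n \<le> Mx" "3 * n \<le> Mx" "n \<le> Mx"
    "3 \<le> Mx" "2 \<le> Mx" "Suc 0 \<le> Mx"
    using M n by linarith+
  have 1: "wp ss \<theta> Mx setup_start (tm setup_start) (I 0) (init_state m n)"
    using bd by (intro vc_sound) (simp add: setup_start_def init_state_def I_def)
  have 2: "wp ss \<theta> Mx (While ?b setup_body) (Suc (m div 2) * (tm setup_body + bsz ?b + 1) + bsz ?b + 1)
      (I (Suc (m div 2))) \<tau>" if "I 0 \<tau>" for \<tau>
  proof (rule wp_For)
    show "wp ss \<theta> Mx setup_body (tm setup_body) (I (Suc k)) \<tau>" if k: "k < Suc (m div 2)" and i: "I k \<tau>" for k \<tau>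
    proof (rule vc_sound)
      have le: "(\<Sum>i<Suc k. Suc n ^ i) \<le> G1.unit"
        using k unfolding G1.unit_def by (intro sum_mono2) auto
      have p: "Suc n ^ k \<le> Mx" "Suc n ^ Suc k \<le> Mx"
        using G1.power_le_cells[of k] G1.power_le_cells[of "Suc k"] k M(1) by linarith+
      have r: "(\<Sum>i<k. Suc n ^ i) \<le> Mx" "(\<Sum>i<k. Suc n ^ i) + Suc n ^ k \<le> Mx"
        using le G1.unit_le M(1) unfolding sum.lessThan_Suc by linarith+
      have kM: "k \<le> Mx" "Suc k \<le> Mx" using k bd by linarith+
      have i': "\<tau> ''i'' 0 = k" "\<tau> ''p'' k = Suc n ^ k" "\<tau> ''B'' 0 = Suc n" "\<tau> ''R'' 0 = (\<Sum>i<k. Suc n ^ i)"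
        using i by (auto simp: I_def)
      have "I (Suc k) (\<tau>(''R'' := (\<tau> ''R'')(0 := (\<Sum>i<k. Suc n ^ i) + Suc n ^ k),
          ''p'' := (\<tau> ''p'')(Suc k := Suc n ^ k * Suc n), ''i'' := (\<tau> ''i'')(0 := Suc k)))"
        using i by (auto simp: I_def le_Suc_eq)
      then show "vc ss \<theta> Mx setup_body (I (Suc k)) \<tau>"
        using i' p r kM bd by (simp add: setup_body_def mult.commute)
    qed
    show "bbnd Mx ?b \<tau> \<and> bval ss \<theta> ?b \<tau> = (k < Suc (m div 2))" if "k \<le> Suc (m div 2)" "I k \<tau>" for k \<tau>
      using that bd by (simp add: I_def)
  qed (rule that)
  have 3: "wp ss \<theta> Mx (setv ''N'' (Arr ''p'' (var ''H''))) (tm (setv ''N'' (Arr ''p'' (var ''H'')))) (round_inv 0) \<tau>"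
    if i: "I (Suc (m div 2)) \<tau>" for \<tau>
  proof (rule vc_sound)
    have "{} \<in> G1.full \<inter> G2.full" by (simp add: G1.full_def G2.full_def)
    then have "\<exists>X\<in>G1.full \<inter> G2.full. card X = 0" by (metis card.empty)
    then have "candidates A 0 0" for A by (simp add: candidates_def)
    moreover have "\<tau> ''p'' (Suc (m div 2)) = G1.cells" "\<tau> ''R'' 0 = G1.unit"
      using i by (simp_all only: I_def G1.cells_def G1.unit_def)
    moreover have "\<forall>i\<le>m div 2. \<tau> ''p'' i = Suc n ^ i" using i by (simp add: I_def)
    ultimately show "vc ss \<theta> Mx (setv ''N'' (Arr ''p'' (var ''H''))) (round_inv 0) \<tau>"
      using i M bd by (simp add: I_def round_inv_def G1.env_def omitted_def)
  qed
  have "wp ss \<theta> Mx setup_prog (tm setup_start + ((Suc (m div 2) * (tm setup_body + bsz ?b + 1) + bsz ?b + 1) +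
      tm (setv ''N'' (Arr ''p'' (var ''H''))))) (round_inv 0) (init_state m n)"
    unfolding setup_prog_def by (intro wp_Seq'[OF 1] wp_Seq'[OF 2] 3)
  then show ?thesis
    by (rule wp_conseq) (simp_all add: setup_start_def setup_body_def)
qed

lemma wp_rounds:
  assumes "round_inv 0 \<sigma>"
  shows "wp ss \<theta> Mx (While (Less (var ''j'') (var ''K'')) round_prog)
    (3 * n * (1000 * (m div 2 + 2) * G1.cells + 9) + 9) (round_inv (3 * n)) \<sigma>"
proof -
  let ?b = "Less (var ''j'') (var ''K'')"
  have "wp ss \<theta> Mx (While ?b round_prog)
      (3 * n * (1000 * (m div 2 + 2) * G1.cells + bsz ?b + 1) + bsz ?b + 1) (round_inv (3 * n)) \<sigma>"
  proof (rule wp_For)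
    show "bbnd Mx ?b \<tau> \<and> bval ss \<theta> ?b \<tau> = (k < 3 * n)" if "k \<le> 3 * n" "round_inv k \<tau>" for k \<tau>
    proof -
      have "3 * n \<le> Mx" "k \<le> Mx" using Mx_bounds(5) that(1) by linarith+
      then show ?thesis using that by (simp add: round_inv_def)
    qed
  qed (use wp_round assms in auto)
  moreover have "bsz ?b + 1 = 9" by simp
  ultimately show ?thesis by (simp only: add.assoc)
qed

definition accept :: "nat \<Rightarrow> nat \<Rightarrow> bool" where
  "accept b D \<longleftrightarrow> 16 * n * (n - b) + 3 * D * D \<le> 32 * n * D"

lemma wp_search:
  assumes "\<sigma> ''n'' 0 = n" "\<sigma> ''b'' 0 = b" "\<sigma> ''D'' 0 = 0" "b \<le> n"
  shows "wp ss \<theta> Mx (While guard_D (incr ''D'')) (100 * n + 100)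
    (\<lambda>\<tau>. \<tau> ''n'' 0 = n \<and> \<tau> ''D'' 0 \<le> n \<and> accept b (\<tau> ''D'' 0) \<and> (\<forall>D<\<tau> ''D'' 0. \<not> accept b D)) \<sigma>"
proof -
  define I where "I \<tau> \<longleftrightarrow> \<tau> ''n'' 0 = n \<and> \<tau> ''b'' 0 = b \<and> \<tau> ''D'' 0 \<le> n \<and> (\<forall>D<\<tau> ''D'' 0. \<not> accept b D)" for \<tau> :: state
  have acc_n: "accept b n"
  proof -
    have "16 * n * (n - b) \<le> 16 * n * n" by (intro mult_le_mono2) simp
    then show ?thesis unfolding accept_def by linarith
  qed
  have g: "bval ss \<theta> guard_D \<tau> \<longleftrightarrow> \<not> accept b (\<tau> ''D'' 0)" if "I \<tau>" for \<tau>
    using that by (auto simp: guard_D_def I_def accept_def)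
  have bd: "64 * (n * n) \<le> Mx" "64 * n \<le> Mx" "64 \<le> Mx" using Mx_bounds by auto
  have "wp ss \<theta> Mx (While guard_D (incr ''D''))
     (n * (tm (incr ''D'') + bsz guard_D + 1) + bsz guard_D + 1) (\<lambda>\<tau>. I \<tau> \<and> \<not> bval ss \<theta> guard_D \<tau>) \<sigma>"
  proof (rule wp_While[where \<mu> = "\<lambda>\<tau>. n - \<tau> ''D'' 0"])
    show "wp ss \<theta> Mx (incr ''D'') (tm (incr ''D'')) (\<lambda>\<tau>'. I \<tau>' \<and> n - \<tau>' ''D'' 0 < n - \<tau> ''D'' 0) \<tau>"
      if i: "I \<tau>" and b: "bval ss \<theta> guard_D \<tau>" for \<tau>
    proof (rule vc_sound)
      have na: "\<not> accept b (\<tau> ''D'' 0)" using g[OF i] b by simp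
      then have "\<tau> ''D'' 0 \<noteq> n" using acc_n by metis
      then have lt: "\<tau> ''D'' 0 < n" using i by (simp add: I_def)
      then have "\<tau> ''D'' 0 \<le> Mx" "Suc (\<tau> ''D'' 0) \<le> Mx" "Suc 0 \<le> Mx" using bd by linarith+
      then show "vc ss \<theta> Mx (incr ''D'') (\<lambda>\<tau>'. I \<tau>' \<and> n - \<tau>' ''D'' 0 < n - \<tau> ''D'' 0) \<tau>"
        using i lt na by (auto simp: I_def less_Suc_eq)
    qed
    show "bbnd Mx guard_D \<tau>" if i: "I \<tau>" for \<tau>
    proof -
      define D where "D = \<tau> ''D'' 0"
      have D: "D \<le> n" using i by (simp add: I_def D_def)
      have "n * D \<le> n * n" "D * D \<le> n * n" "n * (n - b) \<le> n * n"
        using D by (auto intro: mult_le_mono)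
      then have "32 * n * D \<le> Mx" "3 * D * D \<le> Mx" "16 * n * (n - b) \<le> Mx"
        "16 * n * (n - b) + 3 * D * D \<le> Mx" using bd(1) unfolding mult.assoc by linarith+
      moreover have "32 * n \<le> Mx" "16 * n \<le> Mx" "3 * D \<le> Mx" "n \<le> Mx" "D \<le> Mx" "n - b \<le> Mx" "b \<le> Mx"
        "32 \<le> Mx" "16 \<le> Mx" "3 \<le> Mx"
        using bd D assms(4) by linarith+
      ultimately show ?thesis using i by (simp add: guard_D_def I_def D_def)
    qed
    show "I \<sigma>" using assms by (simp add: I_def)
  qed (use assms in simp)
  then show ?thesis
  proof (rule wp_conseq)
    fix \<tau>
    assume a: "I \<tau> \<and> \<not> bval ss \<theta> guard_D \<tau>"
    then have "accept b (\<tau> ''D'' 0)" using g by blast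
    then show "\<tau> ''n'' 0 = n \<and> \<tau> ''D'' 0 \<le> n \<and> accept b (\<tau> ''D'' 0) \<and> (\<forall>D<\<tau> ''D'' 0. \<not> accept b D)"
      using a by (simp add: I_def)
  qed (simp add: guard_D_def)
qed

lemma lcs_attained:
  obtains X where "X \<in> G1.full \<inter> G2.full" "card X = lcs_length ss"
proof -
  let ?L = "{length w |w. \<forall>s\<in>set ss. subseq w s}"
  have s0: "ss ! 0 \<in> set ss" using m length_ss by simp
  have "?L \<subseteq> {..n}" using s0 len list_emb_length by fastforce
  then have "finite ?L" using finite_subset by blast
  moreover have "\<exists>u. 0 = length u \<and> (\<forall>s\<in>set ss. subseq u s)" by (rule exI[of _ "[]"]) simp
  then have "0 \<in> ?L" by blast
  ultimately have "Max ?L \<in> ?L" by (intro Max_in) auto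
  then obtain u where u: "length u = lcs_length ss" "\<forall>s\<in>set ss. subseq u s"
    by (auto simp: lcs_length_def)
  obtain Y where Y: "u = nths (ss ! 0) Y" using u(2) s0 subseq_conv_nths by blast
  define X where "X = Y \<inter> {..<n}"
  have uX: "u = nths (ss ! 0) X" using nths_Int_lessThan_length[of "ss ! 0" Y] G1.len_0 by (simp add: X_def Y)
  have Xn: "X \<subseteq> {..<n}" by (simp add: X_def)
  have "card X = lcs_length ss" using u(1) length_nths_subset[of X "ss ! 0"] Xn G1.len_0 by (simp add: uX)
  moreover have "X \<in> G1.full \<inter> G2.full"
  proof -
    have "ss ! i \<in> set ss" if "i < m" for i using that length_ss by simp
    then show ?thesis using Xn u(2) m unfolding uX G1.full_def G2.full_def by auto
  qed
  ultimately show thesis using that by blast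
qed

lemma card_le_lcs:
  assumes "X \<in> G1.full \<inter> G2.full"
  shows "card X \<le> lcs_length ss"
proof -
  let ?L = "{length w |w. \<forall>s\<in>set ss. subseq w s}"
  have s0: "ss ! 0 \<in> set ss" using m length_ss by simp
  have "?L \<subseteq> {..n}" using s0 len list_emb_length by fastforce
  then have fin: "finite ?L" using finite_subset by blast
  have "subseq (nths (ss ! 0) X) s" if s: "s \<in> set ss" for s
  proof -
    obtain i where i: "i < m" "s = ss ! i" using s length_ss by (auto simp: in_set_conv_nth)
    consider "i = 0" | "i \<in> {1..m div 2}" | "m div 2 < i" using i by fastforce
    then show ?thesis
    proof cases
      case 1
      then show ?thesis using i subseq_conv_nths by blast
    next
      case 2
      then show ?thesis using assms i by (auto simp: G1.full_def)
    next
      case 3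
      define k where "k = i - (m - Suc (m div 2))"
      have "k \<in> {1..m div 2}" "m - Suc (m div 2) + k = i" using 3 i unfolding k_def by auto
      then show ?thesis using assms i unfolding G2.full_def by auto
    qed
  qed
  then have "length (nths (ss ! 0) X) \<in> ?L" by blast
  moreover have "length (nths (ss ! 0) X) = card X"
    using length_nths_subset[of X "ss ! 0"] assms full_subset(1)[of X] G1.len_0 by simp
  ultimately show ?thesis unfolding lcs_length_def using Max_ge[OF fin, of "length (nths (ss ! 0) X)"] by simp
qed

lemma accept_align_dist:
  assumes "candidates A (3 * n) b"
  shows "accept b (align_dist n ss)"
proof -
  obtain X where X: "X \<in> G1.full \<inter> G2.full" "card X = lcs_length ss" using lcs_attained .
  have "\<exists>j<3 * n. 16 * n * (n - card (X \<inter> A j)) + 3 * (n - card X)\<^sup>2 \<le> 32 * n * (n - card X)"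
    using assms X(1) n full_subset(1) unfolding candidates_def omitted_def
    by (intro greedy_rounds[where F = G1.full]) auto
  then obtain j where j: "j < 3 * n" "16 * n * (n - card (X \<inter> A j)) + 3 * (n - card X)\<^sup>2 \<le> 32 * n * (n - card X)"
    by blast
  have "card (X \<inter> A j) \<le> b" using assms X(1) j(1) by (simp add: candidates_def)
  then have "16 * n * (n - b) \<le> 16 * n * (n - card (X \<inter> A j))" by (intro mult_le_mono2 diff_le_mono2)
  then show ?thesis using j(2) unfolding accept_def align_dist_def X(2) power2_eq_square mult.assoc by linarith
qed

lemma accept_sound:
  assumes "accept b D" "real D \<le> \<theta> * real n" "0 < \<theta>" "\<theta> < 1" "candidates A j b"
  shows "real (align_dist n ss) \<le> (2 - 3 * \<theta> / 16) * \<theta> * real n"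
proof -
  have n0: "real n > 0" using n by simp
  obtain X where "X \<in> G1.full \<inter> G2.full" "card X = b" using assms(5) by (auto simp: candidates_def)
  then have "align_dist n ss \<le> n - b" using card_le_lcs by (auto simp: align_dist_def intro: diff_le_mono2)
  moreover have "real (16 * n * (n - b) + 3 * D * D) \<le> real (32 * n * D)"
    using assms(1) unfolding accept_def by (simp only: of_nat_le_iff)
  then have "16 * real n * real (n - b) \<le> 32 * real n * real D - 3 * real D * real D" by simp
  moreover have "32 * real n * real D - 3 * real D * real D \<le> 16 * real n * ((2 - 3 * \<theta> / 16) * \<theta> * real n)"
  proof -
    define x where "x = \<theta> * real n"
    have x: "real D \<le> x" "x \<le> real n" using assms(2,4) n0 by (auto simp: x_def)
    have "0 \<le> (x - real D) * (32 * real n - 3 * (x + real D))"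
      using x by (intro mult_nonneg_nonneg) auto
    then have "32 * real n * real D - 3 * real D * real D \<le> 32 * real n * x - 3 * x * x"
      by (simp add: algebra_simps)
    also have "\<dots> = 16 * real n * ((2 - 3 * \<theta> / 16) * \<theta> * real n)"
      by (simp add: x_def algebra_simps)
    finally show ?thesis .
  qed
  ultimately have "16 * real n * real (n - b) \<le> 16 * real n * ((2 - 3 * \<theta> / 16) * \<theta> * real n)" by linarith
  then have "real (n - b) \<le> (2 - 3 * \<theta> / 16) * \<theta> * real n" using n0 by simp
  then show ?thesis using \<open>align_dist n ss \<le> n - b\<close> by linarith
qed

lemma gap_prog_correct:
  assumes "0 < \<theta>" "\<theta> < 1"
  shows "\<exists>t ans. runs_with gap_prog m n ss \<theta> t ans \<and>
    ans \<in> GapMultiAlignDist n ss \<theta> (2 - 3 * \<theta> / 16) \<and>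
    t \<le> 4000 * n * (m div 2 + 2) * G1.cells * bits Mx"
proof -
  obtain t1 \<sigma>1 where 1: "exec ss \<theta> setup_prog (init_state m n) t1 \<sigma>1" "t1 \<le> 200 * (m div 2 + 2) * bits Mx"
    "round_inv 0 \<sigma>1"
    using wp_setup[of \<theta>] unfolding wp_def by blast
  obtain t2 \<sigma>2 where 2: "exec ss \<theta> (While (Less (var ''j'') (var ''K'')) round_prog) \<sigma>1 t2 \<sigma>2"
    "t2 \<le> (3 * n * (1000 * (m div 2 + 2) * G1.cells + 9) + 9) * bits Mx" "round_inv (3 * n) \<sigma>2"
    using wp_rounds[OF 1(3), of \<theta>] unfolding wp_def by blast
  define b where "b = \<sigma>2 ''b'' 0"
  obtain A where A: "candidates A (3 * n) b" using 2(3) by (auto simp: round_inv_def b_def)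
  have "b \<le> n"
  proof -
    obtain X where X: "X \<in> G2.full" "card X = b" using A by (auto simp: candidates_def)
    have "card X \<le> card {..<n}" using full_subset(2)[OF X(1)] by (intro card_mono) auto
    then show ?thesis using X by simp
  qed
  then have "wp ss \<theta> Mx (While guard_D (incr ''D'')) (100 * n + 100)
    (\<lambda>\<tau>. \<tau> ''n'' 0 = n \<and> \<tau> ''D'' 0 \<le> n \<and> accept b (\<tau> ''D'' 0) \<and> (\<forall>D<\<tau> ''D'' 0. \<not> accept b D)) \<sigma>2"
    using 2(3) by (intro wp_search) (auto simp: round_inv_def G1.env_def b_def)
  then obtain t3 \<sigma>3 where 3: "exec ss \<theta> (While guard_D (incr ''D'')) \<sigma>2 t3 \<sigma>3" "t3 \<le> (100 * n + 100) * bits Mx"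
    "\<sigma>3 ''n'' 0 = n" "\<sigma>3 ''D'' 0 \<le> n" "accept b (\<sigma>3 ''D'' 0)" "\<forall>D<\<sigma>3 ''D'' 0. \<not> accept b D"
    unfolding wp_def by blast
  define D where "D = \<sigma>3 ''D'' 0"
  define ans :: nat where "ans = (if real D \<le> \<theta> * real n then 1 else 0)"
  have "wp ss \<theta> Mx decide (tm decide) (\<lambda>\<tau>. \<tau> ''out'' 0 = ans) \<sigma>3"
  proof (rule vc_sound)
    have "n \<le> Mx" "D \<le> Mx" "Suc 0 \<le> Mx" using Mx_bounds 3(4) by (auto simp: D_def)
    then show "vc ss \<theta> Mx decide (\<lambda>\<tau>. \<tau> ''out'' 0 = ans) \<sigma>3"
      using 3(3) by (simp add: decide_def ans_def D_def)
  qed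
  then obtain t4 \<sigma>4 where 4: "exec ss \<theta> decide \<sigma>3 t4 \<sigma>4" "t4 \<le> 50 * bits Mx" "\<sigma>4 ''out'' 0 = ans"
    unfolding wp_def by (fastforce simp: decide_def)
  have "exec ss \<theta> gap_prog (init_state m n) (t1 + (t2 + (t3 + t4))) \<sigma>4"
    unfolding gap_prog_def by (intro exec.Seq) (fact 1(1) 2(1) 3(1) 4(1))+
  then have "runs_with gap_prog m n ss \<theta> (t1 + (t2 + (t3 + t4))) ans"
    using 4(3) by (auto simp: runs_with_def)
  moreover have "ans \<in> GapMultiAlignDist n ss \<theta> (2 - 3 * \<theta> / 16)"
  proof -
    have "ans = 1" if "real (align_dist n ss) \<le> \<theta> * real n"
    proof -
      have "D \<le> align_dist n ss" using accept_align_dist[OF A] 3(6) unfolding D_def by (meson not_le)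
      then show ?thesis using that by (simp add: ans_def)
    qed
    moreover have "ans = 0" if "real (align_dist n ss) > (2 - 3 * \<theta> / 16) * \<theta> * real n"
      using accept_sound[OF 3(5) _ assms A] that unfolding D_def[symmetric] ans_def by force
    ultimately show ?thesis by (simp add: GapMultiAlignDist_def)
  qed
  moreover have "t1 + (t2 + (t3 + t4)) \<le> 4000 * n * (m div 2 + 2) * G1.cells * bits Mx"
  proof -
    define y where "y = n * ((m div 2 + 2) * G1.cells)"
    have c2: "2 \<le> G1.cells" using G1.cells_gt n by linarith
    have "n * (2 * 2) \<le> y" unfolding y_def using c2 by (intro mult_le_mono2 mult_le_mono) auto
    then have y1: "4 * n \<le> y" by simp
    have "1 * ((m div 2 + 2) * 2) \<le> y" unfolding y_def using c2 n by (intro mult_le_mono) auto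
    then have y2: "2 * (m div 2 + 2) \<le> y" by simp
    have "t1 + (t2 + (t3 + t4)) \<le> (200 * (m div 2 + 2) + (3 * n * (1000 * (m div 2 + 2) * G1.cells + 9) + 9)
        + (100 * n + 100) + 50) * bits Mx"
      using 1(2) 2(2) 3(2) 4(2) unfolding add_mult_distrib by linarith
    also have "\<dots> = (200 * (m div 2 + 2) + 3000 * y + 127 * n + 159) * bits Mx"
      by (simp add: y_def algebra_simps)
    also have "\<dots> \<le> 4000 * y * bits Mx" using y1 y2 n by (intro mult_le_mono1) linarith
    finally show ?thesis unfolding y_def by (simp only: mult_ac)
  qed
  ultimately show ?thesis by blast
qed

end

definition gap_time :: "nat \<Rightarrow> nat \<Rightarrow> nat" where
  "gap_time m n = 4000 * n * (m div 2 + 2) * Suc n ^ Suc (m div 2) * bits (64 * 2 ^ m * Suc n ^ (m div 2 + 3))"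

lemma gap_time_soft_O: "(\<lambda>m n. real (gap_time m n)) \<in> soft_O_m (\<lambda>m n. real n ^ (m div 2 + 2))"
proof -
  have main: "real (gap_time m n) \<le> (352000 ^ m * log 2 (real n + 1) ^ m) * log 2 (real n + 1) ^ 1 * real n ^ (m div 2 + 2)"
    if m: "1 \<le> m" and n: "1 \<le> n" for m n
  proof -
    define L where "L = log 2 (real n + 1)"
    have L1: "L \<ge> 1" using n by (simp add: L_def le_log_iff)
    have "m div 2 + 1 \<le> m" using m by presburger
    then have hm: "real (m div 2) + 1 \<le> real m" by linarith
    define M :: nat where "M = 64 * 2 ^ m * Suc n ^ (m div 2 + 3)"
    have Mpos: "real M > 0" by (simp add: M_def)
    have "log 2 (real M) = log 2 64 + real m * log 2 2 + real (m div 2 + 3) * L"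
      by (simp add: M_def log_mult log_nat_power L_def add.commute)
    also have "log 2 (64::real) = 6" using log_pow_cancel[of 2 6] by simp
    finally have lM: "log 2 (real M) = 6 + real m + real (m div 2 + 3) * L" by simp
    have m2: "real m + 1 \<le> 2 ^ m" using less_exp[of m] by (metis Suc_leI of_nat_Suc of_nat_le_iff of_nat_numeral of_nat_power add.commute)
    have "real (floor_log M) \<le> log 2 (real M)"
      using Mpos by (simp add: floor_log_altdef)
    then have "real (bits M) \<le> 7 + real m + real (m div 2 + 3) * L" by (simp add: bits_def lM)
    also have "\<dots> \<le> (7 + real m) * L + (real m + 2) * L"
    proof (intro add_mono mult_right_mono)
      show "7 + real m \<le> (7 + real m) * L" using mult_left_mono[OF L1, of "7 + real m"] by simp
      show "real (m div 2 + 3) \<le> real m + 2" using hm by simp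
    qed (use L1 in simp)
    also have "\<dots> = (9 + 2 * real m) * L" by (simp add: algebra_simps)
    also have "\<dots> \<le> (11 * 2 ^ m) * L"
      using m2 L1 m by (intro mult_right_mono) linarith+
    finally have bM: "real (bits M) \<le> 11 * 2 ^ m * L" .
    have "real (Suc n ^ Suc (m div 2)) \<le> (2 * real n) ^ Suc (m div 2)"
      unfolding of_nat_power using n by (intro power_mono) auto
    also have "\<dots> = 2 ^ Suc (m div 2) * real n ^ Suc (m div 2)" by (rule power_mult_distrib)
    also have "\<dots> \<le> 2 ^ m * real n ^ Suc (m div 2)"
      using hm by (intro mult_right_mono power_increasing) auto
    finally have c: "real (Suc n ^ Suc (m div 2)) \<le> 2 ^ m * real n ^ Suc (m div 2)" .
    have h: "real (m div 2 + 2) \<le> 2 ^ m"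
    proof -
      have "real (m div 2 + 2) \<le> real m + 1" using hm by simp
      then show ?thesis using m2 by linarith
    qed
    have "real (gap_time m n) = 4000 * (real n * (real (m div 2 + 2) * (real (Suc n ^ Suc (m div 2)) * real (bits M))))"
      unfolding gap_time_def M_def[symmetric] by (simp only: of_nat_mult of_nat_numeral mult.assoc)
    also have "\<dots> \<le> 4000 * (real n * (2 ^ m * ((2 ^ m * real n ^ Suc (m div 2)) * (11 * 2 ^ m * L))))"
      using h c bM L1 by (intro mult_left_mono mult_mono) auto
    also have "\<dots> = 44000 * (2 * 2 * 2) ^ m * L * real n ^ (m div 2 + 2)"
      unfolding power_mult_distrib by (simp add: mult_ac)
    also have "\<dots> \<le> 44000 ^ m * (2 * 2 * 2) ^ m * L * real n ^ (m div 2 + 2)"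
    proof -
      have "(44000::real) ^ 1 \<le> 44000 ^ m" using m by (intro power_increasing) auto
      then show ?thesis using L1 by (intro mult_right_mono) auto
    qed
    also have "\<dots> = 352000 ^ m * L * real n ^ (m div 2 + 2)"
      by (simp add: power_mult_distrib[symmetric])
    also have "\<dots> \<le> 352000 ^ m * L ^ m * L * real n ^ (m div 2 + 2)"
    proof -
      have "(352000::real) ^ m * 1 \<le> 352000 ^ m * L ^ m" using L1 by (intro mult_left_mono one_le_power) auto
      then show ?thesis using L1 by (intro mult_right_mono) auto
    qed
    finally show ?thesis by (simp add: L_def)
  qed
  show ?thesis unfolding soft_O_m_def
    by (rule CollectI, rule exI[of _ 352000], rule exI[of _ 1]) (use main in auto)
qed

theorem theorem4:
  shows "\<exists>(P :: com) (T :: nat \<Rightarrow> nat \<Rightarrow> real).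
    T \<in> soft_O_m (\<lambda>m n. real n ^ (m div 2 + 2)) \<and>
    (\<forall>(m::nat) (n::nat) (\<Sigma> :: 'a set) (ss :: 'a list list) (\<theta>::real).
       m \<ge> 1 \<and> n \<ge> 1 \<and> length ss = m \<and>
       (\<forall>s \<in> set ss. length s = n \<and> set s \<subseteq> \<Sigma>) \<and> 0 < \<theta> \<and> \<theta> < 1 \<longrightarrow>
       (\<exists>t ans. runs_with P m n ss \<theta> t ans \<and>
          ans \<in> GapMultiAlignDist n ss \<theta> (2 - 3 * \<theta> / 16) \<and> real t \<le> T m n))"
proof (rule exI[of _ gap_prog], rule exI[of _ "\<lambda>m n. real (gap_time m n)"], intro conjI allI impI)
  show "(\<lambda>m n. real (gap_time m n)) \<in> soft_O_m (\<lambda>m n. real n ^ (m div 2 + 2))"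
    by (rule gap_time_soft_O)
  fix m n :: nat and \<Sigma> :: "'a set" and ss :: "'a list list" and \<theta> :: real
  assume a: "m \<ge> 1 \<and> n \<ge> 1 \<and> length ss = m \<and>
     (\<forall>s \<in> set ss. length s = n \<and> set s \<subseteq> \<Sigma>) \<and> 0 < \<theta> \<and> \<theta> < 1"
  then interpret strings ss n m by unfold_locales auto
  show "\<exists>t ans. runs_with gap_prog m n ss \<theta> t ans \<and>
      ans \<in> GapMultiAlignDist n ss \<theta> (2 - 3 * \<theta> / 16) \<and> real t \<le> real (gap_time m n)"
    using gap_prog_correct[of \<theta>] a unfolding gap_time_def Mx_def[symmetric] G1.cells_def[symmetric]
    by (auto simp only: of_nat_le_iff)
qed

end
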